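(* Let $p$ be an odd prime and let $E$ be the elliptic curve $y^2=x^3-p^2x$ over $\mathbb{Q}$. Then the rank $r(E)$ of $E(\mathbb{Q})$ equals $2$ if and only if $p$ is both $\alpha_{-}^{\pm}$Pythagorean and $\beta_{-}$Pythagorean.
   Context: Definitions. $p$ is $\alpha_{-}^{-}$Pythagorean if there are coprime integers $a,b,c$ such that $pc^2=a^2+b^2$ and $(a-2b)^2+b^2$ is a perfect square. $p$ is $\alpha_{-}^{+}$Pythagorean if there are coprime integers $a,b,c$ such that $pc^2=a^2+b^2$ and $(a+2b)^2+b^2$ is a perfect square. $p$ is $\alpha_{-}^{\pm}$Pythagorean if it is $\alpha_{-}^{-}$Pythagorean or $\alpha_{-}^{+}$Pythagorean. $p$ is $\beta_{-}$Pythagorean if there are integers $a,e,m,u$ such that $pe^2m^2=2a^2-u^2$, $pe^2=2a-m^2$ and $\gcd(e,m)=1$. *)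

theory Defs
  imports
    "HOL-Algebra.FiniteProduct"
    "HOL-Computational_Algebra.Primes"
    "HOL-Computational_Algebra.Nth_Powers"
    "HOL-Library.Extended_Nat"
begin

datatype 'a ec_point = Infinity | Point 'a 'a

definition ec_points :: "'a::field \<Rightarrow> 'a \<Rightarrow> 'a ec_point set" where
  "ec_points A B = insert Infinity {Point x y | x y. y ^ 2 = x ^ 3 + A * x + B}"

(* The chord-tangent law. For points of the curve with equal abscissae, the ordinates agree
   up to sign, so in the "x1 = x2" branch of the slope the two points coincide and the slope
   is that of the tangent. *)
fun ec_add :: "'a::field \<Rightarrow> 'a ec_point \<Rightarrow> 'a ec_point \<Rightarrow> 'a ec_point" where
  "ec_add A Infinity Q = Q"
| "ec_add A (Point x y) Infinity = Point x y"
| "ec_add A (Point x1 y1) (Point x2 y2) =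
    (if x1 = x2 \<and> y1 = - y2 then Infinity
     else let l = (if x1 = x2 then (3 * x1 ^ 2 + A) / (2 * y1) else (y2 - y1) / (x2 - x1));
              x3 = l ^ 2 - x1 - x2
          in Point x3 (l * (x1 - x3) - y1))"

(* The group of points, rational over the field 'a, of y^2 = x^3 + A x + B. It is intended for
   fields of characteristic different from 2 and 3 and for 4 A^3 + 27 B^2 \<noteq> 0. The abelian
   group is written multiplicatively, following HOL-Algebra. *)
definition ec_group :: "'a::field \<Rightarrow> 'a \<Rightarrow> 'a ec_point monoid" where
  "ec_group A B = \<lparr>carrier = ec_points A B, monoid.mult = ec_add A, one = Infinity\<rparr>"

(* Linear independence over the integers of a finite subset of an abelian group. *)
definition int_independent :: "('a, 'm) monoid_scheme \<Rightarrow> 'a set \<Rightarrow> bool" where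
  "int_independent G S \<longleftrightarrow> finite S \<and> S \<subseteq> carrier G \<and>
     (\<forall>c :: 'a \<Rightarrow> int.
        finprod G (\<lambda>x. x [^]\<^bsub>G\<^esub> c x) S = \<one>\<^bsub>G\<^esub> \<longrightarrow> (\<forall>x\<in>S. c x = 0))"

(* Rank of an abelian group: the largest number of independent elements. The value is infinite
   when there is no bound, so an equation with a natural number also asserts finiteness. *)
definition abelian_rank :: "('a, 'm) monoid_scheme \<Rightarrow> enat" where
  "abelian_rank G = (SUP S \<in> {S. int_independent G S}. enat (card S))"

(* "Coprime a, b, c" is read as gcd(a, b, c) = 1. For squarefree p, the equation
   p c^2 = a^2 + b^2 then makes a, b coprime. *)
definition alpha_minus_minus_Pythagorean :: "int \<Rightarrow> bool" where
  "alpha_minus_minus_Pythagorean p \<longleftrightarrow>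
     (\<exists>a b c :: int. Gcd {a, b, c} = 1 \<and> p * c ^ 2 = a ^ 2 + b ^ 2 \<and>
        is_square ((a - 2 * b) ^ 2 + b ^ 2))"

definition alpha_minus_plus_Pythagorean :: "int \<Rightarrow> bool" where
  "alpha_minus_plus_Pythagorean p \<longleftrightarrow>
     (\<exists>a b c :: int. Gcd {a, b, c} = 1 \<and> p * c ^ 2 = a ^ 2 + b ^ 2 \<and>
        is_square ((a + 2 * b) ^ 2 + b ^ 2))"

definition alpha_minus_pm_Pythagorean :: "int \<Rightarrow> bool" where
  "alpha_minus_pm_Pythagorean p \<longleftrightarrow>
     alpha_minus_minus_Pythagorean p \<or> alpha_minus_plus_Pythagorean p"

definition beta_minus_Pythagorean :: "int \<Rightarrow> bool" where
  "beta_minus_Pythagorean p \<longleftrightarrow>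
     (\<exists>a e m u :: int. p * e ^ 2 * m ^ 2 = 2 * a ^ 2 - u ^ 2 \<and>
        p * e ^ 2 = 2 * a - m ^ 2 \<and> gcd e m = 1)"

end

theory Submission
  imports Defs "HOL-Computational_Algebra.Squarefree" Complex_Main
begin

text \<open>Complete 2-descent on E: y^2 = x (x - p) (x + p). The square classes of x and x + p define a
  homomorphism on E(\<rat>) with kernel 2 E(\<rat>) and image inside {\<plusminus>1, \<plusminus>p} \<times> {1, 2, p, 2 p}, a
  group of order 16 in which the torsion E[2] has an image of order 4. Translating by torsion makes x a
  square, so E(\<rat>) / (2 E(\<rat>) + E[2]) embeds into {1, 2, p, 2 p}, the class of x + p. A naive
  height shows that a set of at most three independent points can be replaced by one of the same size which
  is independent modulo 2 E(\<rat>) + E[2]. Hence the rank is at most 2, and it is 2 iff both classes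
  2 and p occur. A point of class 2 amounts to a solution of the beta condition, a point of class p to a
  solution of the alpha condition.\<close>

section \<open>The group law\<close>

text \<open>The obstacle is that independence over the integers says nothing modulo 2: independent
  points may all be doubles. \<open>abelian_rank\<close> is a supremum over independent sets and
  offers no basis, so a given set must first be improved, and heights make that process stop. Why
  three points: a signed sum of k points of height at most B can be kept below k B + O(1), and
  halving divides heights by four, so the half stays below a large B for k = 1, 2, 3. Three is just
  enough, since three vectors over the field with two elements are dependent in the quotient, whose
  order is at most 4. Conversely, independence of points of classes 2 and p comes from infinite
  descent on the coefficients of a relation, which rests on the absence of points of order 4.

  The quartics behind both conditions have one origin. In class k one has x = r^2, x + n = k s^2, x
  - n = k v^2, hence k (s - v) (s + v) = 2 n. With t = s + v this becomes 2 r^2 t^2 = t^4 + n^2 for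
  k = 2, and 4 r^2 t^2 = n (t^4 + 4) for k = n.\<close>

locale weierstrass_curve =
  fixes A B :: "'a::field"
  assumes two_nonzero: "(2::'a) \<noteq> 0"
    and nonsingular: "\<And>x. x ^ 3 + A * x + B = 0 \<Longrightarrow> 3 * x ^ 2 + A \<noteq> 0"
begin

abbreviation add (infixl "\<oplus>" 65) where "P \<oplus> Q \<equiv> ec_add A P Q"
abbreviation "E \<equiv> ec_points A B"

fun neg :: "'a ec_point \<Rightarrow> 'a ec_point" where
  "neg Infinity = Infinity"
| "neg (Point x y) = Point x (- y)"

text \<open>Comparing coefficients, the equations say that y = l x + m passes through the three points and
  x^3 + A x + B - (l x + m)^2 = (x - x1) (x - x2) (x - x3); so they carry the right multiplicities
  when abscissae coincide.\<close>

definition on_line where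
  "on_line l m x1 y1 x2 y2 x3 y3 \<longleftrightarrow>
     y1 = l * x1 + m \<and> y2 = l * x2 + m \<and> y3 = l * x3 + m \<and>
     l ^ 2 = x1 + x2 + x3 \<and> A - 2 * l * m = x1 * x2 + x1 * x3 + x2 * x3 \<and>
     m ^ 2 - B = x1 * x2 * x3"

lemma on_line_swap12: "on_line l m x1 y1 x2 y2 x3 y3 \<Longrightarrow> on_line l m x2 y2 x1 y1 x3 y3"
  by (auto simp: on_line_def mult.commute mult.left_commute add_ac)

lemma on_line_swap23: "on_line l m x1 y1 x2 y2 x3 y3 \<Longrightarrow> on_line l m x1 y1 x3 y3 x2 y2"
  by (auto simp: on_line_def mult.commute mult.left_commute add_ac)

lemma Point_in_E [simp]: "Point x y \<in> E \<longleftrightarrow> y ^ 2 = x ^ 3 + A * x + B"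
  by (auto simp: ec_points_def)

lemma Infinity_in_E [simp]: "Infinity \<in> E"
  by (auto simp: ec_points_def)

lemma on_line_imp_point:
  assumes "on_line l m x1 y1 x2 y2 x3 y3"
  shows "y1 ^ 2 = x1 ^ 3 + A * x1 + B" "y2 ^ 2 = x2 ^ 3 + A * x2 + B" "y3 ^ 2 = x3 ^ 3 + A * x3 + B"
proof -
  have *: "y1 = l * x1 + m" "y2 = l * x2 + m" "y3 = l * x3 + m" "l ^ 2 = x1 + x2 + x3"
    "A - 2 * l * m = x1 * x2 + x1 * x3 + x2 * x3" "m ^ 2 - B = x1 * x2 * x3"
    using assms by (auto simp: on_line_def)
  show "y1 ^ 2 = x1 ^ 3 + A * x1 + B" using *(1,4-6) by algebra
  show "y2 ^ 2 = x2 ^ 3 + A * x2 + B" using *(2,4-6) by algebra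
  show "y3 ^ 2 = x3 ^ 3 + A * x3 + B" using *(3,4-6) by algebra
qed

text \<open>An opposite pair lying on y = l x + m has y1 = y2 = 0, and then x1 is a double root of
  the cubic, which nonsingularity excludes. So such a line never leads into the
  \<open>Infinity\<close> branch of \<open>ec_add\<close>.\<close>

lemma on_line_not_neg:
  assumes "on_line l m x1 y1 x2 y2 x3 y3"
  shows "\<not> (x1 = x2 \<and> y1 = - y2)"
proof
  assume "x1 = x2 \<and> y1 = - y2"
  then have xx: "x1 = x2" and yn: "y1 = - y2" by auto
  have "y1 = l * x1 + m" "y2 = l * x2 + m" using assms by (simp_all add: on_line_def)
  then have "y1 = y2" unfolding xx by (rule trans[OF _ sym])
  then have "y1 = - y1" using yn by simp
  then have "y1 + y1 = 0" by (simp only: eq_neg_iff_add_eq_0)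
  then have "2 * y1 = 0" by (simp only: mult_2)
  then have y1: "y1 = 0" using two_nonzero by simp
  have "x1 ^ 3 + A * x1 + B = 0" using on_line_imp_point(1)[OF assms] y1 by simp
  moreover have "3 * x1 ^ 2 + A = 0"
  proof -
    have "0 = l * x1 + m" "l ^ 2 = x1 + x1 + x3" "A - 2 * l * m = x1 * x1 + x1 * x3 + x1 * x3"
      using assms unfolding y1 xx[symmetric] on_line_def by simp_all
    then show ?thesis by algebra
  qed
  ultimately show False using nonsingular by blast
qed

text \<open>Any line, however it was found, certifies a sum: for \<open>x1 = x2\<close> the
  equations between coefficients already force \<open>l\<close> to be the tangent slope.\<close>

lemma add_eq_of_on_line:
  assumes ol: "on_line l m x1 y1 x2 y2 x3 y3"
  shows "Point x1 y1 \<oplus> Point x2 y2 = Point x3 (- y3)"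
proof -
  have nn: "\<not> (x1 = x2 \<and> y1 = - y2)" using on_line_not_neg[OF ol] .
  define s where "s = (if x1 = x2 then (3 * x1 ^ 2 + A) / (2 * y1) else (y2 - y1) / (x2 - x1))"
  have "s = l"
  proof (cases "x1 = x2")
    case True
    then have yy: "y1 = y2" using ol by (simp add: on_line_def)
    then have "2 * y1 \<noteq> 0" using nn True two_nonzero by (auto simp: eq_neg_iff_add_eq_0 mult_2[symmetric])
    moreover have "3 * x1 ^ 2 + A = l * (2 * y1)"
    proof -
      have "y1 = l * x1 + m" "l ^ 2 = x1 + x1 + x3" "A - 2 * l * m = x1 * x1 + x1 * x3 + x1 * x3"
        using ol True by (auto simp: on_line_def)
      then show ?thesis by algebra
    qed
    ultimately show ?thesis using True by (simp add: s_def)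
  next
    case False
    have "y2 - y1 = l * (x2 - x1)" using ol by (simp add: on_line_def algebra_simps)
    then show ?thesis using False by (simp add: s_def)
  qed
  moreover have "l ^ 2 - x1 - x2 = x3" using ol by (simp add: on_line_def)
  moreover have "l * (x1 - x3) - y1 = - y3" using ol by (simp add: on_line_def algebra_simps)
  ultimately show ?thesis using nn unfolding ec_add.simps Let_def s_def[symmetric] by auto
qed

lemma on_line_exists:
  assumes P: "y1 ^ 2 = x1 ^ 3 + A * x1 + B" and Q: "y2 ^ 2 = x2 ^ 3 + A * x2 + B"
    and nn: "\<not> (x1 = x2 \<and> y1 = - y2)"
  obtains l m x3 y3 where "on_line l m x1 y1 x2 y2 x3 y3"
proof (cases "x1 = x2")
  case True
  have "(y1 - y2) * (y1 + y2) = 0" using P Q unfolding True by algebra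
  then have yy: "y1 = y2" using nn True by (auto simp: eq_neg_iff_add_eq_0)
  then have y0: "2 * y1 \<noteq> 0" using nn True two_nonzero by (auto simp: eq_neg_iff_add_eq_0 mult_2[symmetric])
  define l where "l = (3 * x1 ^ 2 + A) / (2 * y1)"
  have l: "l * (2 * y1) = 3 * x1 ^ 2 + A" using y0 by (simp add: l_def)
  have 1: "A - 2 * l * (y1 - l * x1) = x1 * x1 + x1 * (l ^ 2 - x1 - x1) + x1 * (l ^ 2 - x1 - x1)"
    using l by algebra
  have 2: "(y1 - l * x1) ^ 2 - B = x1 * x1 * (l ^ 2 - x1 - x1)" using l P by algebra
  have "on_line l (y1 - l * x1) x1 y1 x2 y2 (l ^ 2 - x1 - x2) (l * (l ^ 2 - x1 - x2) + (y1 - l * x1))"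
    unfolding on_line_def using 1 2 True yy by auto
  then show ?thesis by (rule that)
next
  case False
  define l where "l = (y2 - y1) / (x2 - x1)"
  have l: "l * (x2 - x1) = y2 - y1" using False by (simp add: l_def)
  have d: "x2 - x1 \<noteq> 0" using False by simp
  \<comment> \<open>The curve equations and the chord slope give this identity only up to the factor
    \<open>x2 - x1\<close>, which is then cancelled.\<close>
  have *: "(x2 - x1) * (A - 2 * l * (y1 - l * x1)) = (x2 - x1) * (x1 * x2 + x1 * (l ^ 2 - x1 - x2) + x2 * (l ^ 2 - x1 - x2))"
    using l P Q by algebra
  have **: "A - 2 * l * (y1 - l * x1) = x1 * x2 + x1 * (l ^ 2 - x1 - x2) + x2 * (l ^ 2 - x1 - x2)"
    using * d by simp
  have ***: "(y1 - l * x1) ^ 2 - B = x1 * x2 * (l ^ 2 - x1 - x2)"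
    using ** P by algebra
  have "on_line l (y1 - l * x1) x1 y1 x2 y2 (l ^ 2 - x1 - x2) (l * (l ^ 2 - x1 - x2) + (y1 - l * x1))"
    unfolding on_line_def
  proof (intro conjI)
    show "y2 = l * x2 + (y1 - l * x1)" using l by (simp add: algebra_simps)
  qed (use ** *** in simp_all)
  then show ?thesis by (rule that)
qed

section \<open>Group axioms for chord-tangent addition\<close>

lemma add_cases [consumes 2, case_names Inf1 Inf2 inverse line]:
  assumes "P \<in> E" "Q \<in> E"
  obtains "P = Infinity" | "Q = Infinity" | "Q = neg P"
    | l m x1 y1 x2 y2 x3 y3 where "P = Point x1 y1" "Q = Point x2 y2"
        "P \<oplus> Q = Point x3 (- y3)" "on_line l m x1 y1 x2 y2 x3 y3"
proof (cases P)
  case P: (Point x1 y1)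
  show thesis
  proof (cases Q)
    case Q: (Point x2 y2)
    show thesis
    proof (cases "x1 = x2 \<and> y1 = - y2")
      case True then show ?thesis using that(3) P Q by simp
    next
      case False
      obtain l m x3 y3 where "on_line l m x1 y1 x2 y2 x3 y3"
        using on_line_exists[OF _ _ False] assms P Q Point_in_E by metis
      then show ?thesis using that(4) P Q add_eq_of_on_line by metis
    qed
  qed (use that in auto)
qed (use that in auto)

lemma neg_neg [simp]: "neg (neg P) = P" by (cases P) auto
lemma neg_in_E [simp]: "neg P \<in> E \<longleftrightarrow> P \<in> E" by (cases P) auto
lemma add_Infinity [simp]: "P \<oplus> Infinity = P" by (cases P) auto
lemma add_neg [simp]: "P \<oplus> neg P = Infinity" "neg P \<oplus> P = Infinity" by (cases P; simp)+

lemma add_closed: assumes "P \<in> E" "Q \<in> E" shows "P \<oplus> Q \<in> E"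
  using assms
proof (cases rule: add_cases)
  case (line l m x1 y1 x2 y2 x3 y3)
  then show ?thesis using on_line_imp_point(3)[OF line(4)] by simp
qed (use assms in auto)

lemma add_commute: assumes "P \<in> E" "Q \<in> E" shows "P \<oplus> Q = Q \<oplus> P"
  using assms
proof (cases rule: add_cases)
  case (line l m x1 y1 x2 y2 x3 y3)
  then show ?thesis using add_eq_of_on_line[OF on_line_swap12[OF line(4)]] by simp
qed (use assms in auto)

lemma on_line_neg: "on_line l m x1 y1 x2 y2 x3 y3 \<Longrightarrow> on_line (- l) (- m) x1 (- y1) x2 (- y2) x3 (- y3)"
  by (simp add: on_line_def)

text \<open>The reflected line passes through -P, P + Q and -Q; read in this order it is the
  claim.\<close>

lemma neg_add_cancel: assumes "P \<in> E" "Q \<in> E" shows "neg P \<oplus> (P \<oplus> Q) = Q"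
  using assms
proof (cases rule: add_cases)
  case (line l m x1 y1 x2 y2 x3 y3)
  have "on_line (- l) (- m) x1 (- y1) x3 (- y3) x2 (- y2)"
    using on_line_neg[OF on_line_swap23[OF line(4)]] .
  from add_eq_of_on_line[OF this] show ?thesis using line by simp
qed (use assms in auto)

lemma add_neg_cancel: assumes "P \<in> E" "Q \<in> E" shows "P \<oplus> (neg P \<oplus> Q) = Q"
  using neg_add_cancel[of "neg P" Q] assms by simp

lemma add_eq_neg_rotate:
  assumes "P \<in> E" "Q \<in> E" "R \<in> E" "P \<oplus> Q = neg R" shows "Q \<oplus> R = neg P"
proof -
  have "neg P \<oplus> neg R = Q" using neg_add_cancel[of P Q] assms by simp
  then have "R \<oplus> Q = neg P" using add_neg_cancel[of R "neg P"] assms add_commute[of "neg P" "neg R"] by simp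
  then show ?thesis using add_commute assms by simp
qed

text \<open>The parabola y = a x^2 + b x + c with 1 / a = l + k passes through P, Q, R and - (P + Q + R).
  It can be recovered from the lines used to add in either order: the quadratic minus the line
  through two of the four points is a times the product of the corresponding linear factors.\<close>

lemma add_assoc_generic:
  assumes L: "on_line l m x1 y1 x2 y2 xs ys" and M: "on_line k j xs (- ys) x3 y3 x4 y4"
    and N: "on_line u v x2 y2 x3 y3 xt yt" and lk: "l + k \<noteq> 0"
  shows "Point x1 y1 \<oplus> (Point x2 y2 \<oplus> Point x3 y3) = Point x4 (- y4)"
proof -
  have L': "y1 = l * x1 + m" "y2 = l * x2 + m" "ys = l * xs + m" "l ^ 2 = x1 + x2 + xs"
    "A - 2 * l * m = x1 * x2 + x1 * xs + x2 * xs" "m ^ 2 - B = x1 * x2 * xs"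
    using L by (auto simp: on_line_def)
  have M': "- ys = k * xs + j" "y3 = k * x3 + j" "y4 = k * x4 + j" "k ^ 2 = xs + x3 + x4"
    "A - 2 * k * j = xs * x3 + xs * x4 + x3 * x4"
    using M by (auto simp: on_line_def)
  have N': "y2 = u * x2 + v" "y3 = u * x3 + v" "yt = u * xt + v" "u ^ 2 = x2 + x3 + xt"
    "A - 2 * u * v = x2 * x3 + x2 * xt + x3 * xt"
    using N by (auto simp: on_line_def)
  define a where "a = inverse (l + k)"
  have a: "a * (l + k) = 1" using lk by (simp add: a_def)
  have mj: "m + j = - (l + k) * xs" using L'(3) M'(1) by algebra
  have xs: "xs = - a * (m + j)" using mj a by algebra
  define b c where "b = l - a * (x1 + x2)" and "c = m + a * (x1 * x2)"
  have b: "b = k - a * (x3 + x4)" using a L'(4) M'(4) unfolding b_def by algebra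
  have "(l + k) * (m + a * (x1 * x2)) = (l + k) * (j + a * (x3 * x4))"
    using a L'(4) M'(4) mj L'(5) M'(5) by algebra
  then have c: "c = j + a * (x3 * x4)" using lk unfolding c_def by simp
  have q: "y1 = a * x1 ^ 2 + b * x1 + c" "y2 = a * x2 ^ 2 + b * x2 + c"
    using b_def c_def L'(1,2) by algebra+
  have q': "y3 = a * x3 ^ 2 + b * x3 + c" "y4 = a * x4 ^ 2 + b * x4 + c"
    using b c M'(2,3) by algebra+
  \<comment> \<open>\<open>q3\<close> to \<open>q0\<close> compare coefficients in (a x^2 + b x +
    c)^2 - (x^3 + A x + B) = a^2 (x - x1) (x - x2) (x - x3) (x - x4).\<close>
  have q3: "2 * a * b = 1 - a ^ 2 * (x1 + x2 + x3 + x4)" using b_def b a by algebra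
  have q2: "b ^ 2 + 2 * a * c = a ^ 2 * (x1 * x2 + x3 * x4 + (x1 + x2) * (x3 + x4))"
    using b_def b c_def c L'(4) xs a by algebra
  have q1: "2 * b * c = A - a ^ 2 * (x1 * x2 * (x3 + x4) + x3 * x4 * (x1 + x2))"
    using b_def b c_def c L'(5) xs a by algebra
  have q0: "c ^ 2 - B = a ^ 2 * x1 * x2 * x3 * x4" using c_def c L'(6) xs by algebra
  \<comment> \<open>This is the slope of the parabola's chord over x2, x3. If x2 = x3, two equal
    points do not fix a slope; the tangent slope of the curve is used instead, after multiplication
    by 2 y2, which is nonzero by \<open>on_line_not_neg\<close>.\<close>
  have u: "u = b + a * (x2 + x3)"
  proof (cases "x2 = x3")
    case False
    have "(x2 - x3) * (u - b - a * (x2 + x3)) = 0" using q(2) q'(1) N'(1,2) by algebra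
    then have "u - b - a * (x2 + x3) = 0" using False by simp
    then show ?thesis by (simp add: algebra_simps)
  next
    case True
    have "y3 = y2" using N'(1,2) True by simp
    then have "y2 \<noteq> - y2" using on_line_not_neg[OF N] True by simp
    then have y: "2 * y2 \<noteq> 0" by (simp only: eq_neg_iff_add_eq_0 mult_2 not_False_eq_True)
    have 1: "2 * y2 * u = 3 * x2 ^ 2 + A" using N'(1,4,5) unfolding True[symmetric] by algebra
    have 2: "2 * y2 * l = 3 * x2 ^ 2 + A - (x2 - x1) * (x2 - xs)" using L'(2,4,5) by algebra
    have y2: "y2 = k * x2 + j" using True N'(1,2) M'(2) by simp
    have 3: "x2 - xs = a * (2 * y2)" using xs a L'(2) y2 by algebra
    have "2 * y2 * (u - (l - a * (x1 + x2)) - a * (x2 + x2)) = 0" using 1 2 3 by algebra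
    with y have "u - (l - a * (x1 + x2)) - a * (x2 + x2) = 0" by (metis mult_eq_0_iff)
    then show ?thesis using True by (simp add: b_def algebra_simps)
  qed
  have v: "v = c - a * x2 * x3" using u N'(1) q(2) by algebra
  have xt: "xt = a ^ 2 * (x2 * x3 + x1 * x4) - 2 * a * c" using q3 q2 u N'(4) by algebra
  \<comment> \<open>The parabola minus a (x - x1) (x - x4): the line through P and (x4, y4). Its
    third point turns out to be (xt, -yt), that is Q + R.\<close>
  define w z where w: "w = b + a * (x1 + x4)" and z: "z = c - a * x1 * x4"
  have bb: "2 * b = l + k - a * (x1 + x2 + x3 + x4)" using b_def b by algebra
  have wu: "a * (w + u) = 1" using a bb w u by algebra
  have 1: "w ^ 2 = x1 + xt + x4" using q3 q2 w xt by algebra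
  have 2: "A - 2 * w * z = x1 * xt + x1 * x4 + xt * x4" using q3 q1 w z xt by algebra
  have 3: "z ^ 2 - B = x1 * xt * x4" using q0 z xt by algebra
  have 4: "- yt = w * xt + z" using xt w z u v N'(3) wu by algebra
  have 5: "y1 = w * x1 + z" using q(1) w z by algebra
  have 6: "y4 = w * x4 + z" using q'(2) w z by algebra
  have "on_line w z x1 y1 xt (- yt) x4 y4" unfolding on_line_def using 1 2 3 4 5 6 by simp
  from add_eq_of_on_line[OF this] add_eq_of_on_line[OF N] show ?thesis by simp
qed

text \<open>The parabola needs three lines and \<open>l + k \<noteq> 0\<close>. What escapes it: a
  point at infinity, an opposite pair in one of the sums, or \<open>l + k = 0\<close>, where the
  parabola degenerates and R is -P or -Q. These cases reduce to cancellation laws.\<close>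

lemma add_assoc:
  assumes P: "P \<in> E" and Q: "Q \<in> E" and R: "R \<in> E"
  shows "(P \<oplus> Q) \<oplus> R = P \<oplus> (Q \<oplus> R)"
proof -
  note [simp] = P Q R add_closed
  have flip: "(X \<oplus> neg Y) \<oplus> Y = X" if "X \<in> E" "Y \<in> E" for X Y
    using neg_add_cancel[of "neg Y" X] that add_commute[of X "neg Y"] add_commute[of Y "neg Y \<oplus> X"] by simp
  have flip': "(X \<oplus> Y) \<oplus> neg Y = X" if "X \<in> E" "Y \<in> E" for X Y
    using flip[of X "neg Y"] that by simp
  from P Q show ?thesis
  proof (cases rule: add_cases)
    case inverse
    then show ?thesis using add_neg_cancel[of P R] by simp
  next
    case L: (line l m x1 y1 x2 y2 xs ys)
    have PQ: "P \<oplus> Q \<in> E" by simp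
    from Q R show ?thesis
    proof (cases rule: add_cases)
      case inverse
      then show ?thesis using flip' by simp
    next
      case N: (line u v x2' y2' x3 y3 xt yt)
      have [simp]: "x2' = x2" "y2' = y2" using L N by auto
      from PQ R show ?thesis
      proof (cases rule: add_cases)
        case inverse
        then have "P \<oplus> Q = neg R" by simp
        from add_eq_neg_rotate[OF P Q R this] show ?thesis using inverse by simp
      next
        case M: (line k j xs' ys' x3' y3' x4 y4)
        have [simp]: "x3' = x3" "y3' = y3" "xs' = xs" "ys' = - ys" using L M N by auto
        show ?thesis
        proof (cases "l + k = 0")
          case False
          show ?thesis
            using add_assoc_generic[of l m x1 y1 x2 y2 xs ys k j x3 y3 x4 y4 u v xt yt] L M N False
            by simp
        next
          case True
          then have k: "k = - l" by (simp add: add_eq_0_iff)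
          have *: "ys = l * xs + m" "l ^ 2 = x1 + x2 + xs" "A - 2 * l * m = x1 * x2 + x1 * xs + x2 * xs"
            "- ys = - l * xs + j" "y3 = - l * x3 + j" "l ^ 2 = xs + x3 + x4"
            "A - 2 * (- l) * j = xs * x3 + xs * x4 + x3 * x4"
            using L(4) M(4) by (auto simp: on_line_def k)
          have j: "j = - m" using *(1,4) by algebra
          have y3: "y3 + l * x3 + m = 0" using *(5) j by algebra
          \<comment> \<open>The second line is now the reflection of the first, so x3, x4 have the
            same sum and product as x1, x2.\<close>
          have "(x3 - x1) * (x3 - x2) = 0" using *(2,3,6,7) j by algebra
          then consider "x3 = x1" | "x3 = x2" by auto
          then show ?thesis
          proof cases
            case 1
            have "y1 = l * x1 + m" using L(4) by (simp add: on_line_def)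
            then have "y3 = - y1" using y3 unfolding 1 by algebra
            then have "R = neg P" using L(1,2) N(2) 1 by simp
            then show ?thesis using flip'[of Q P] add_commute[of P Q] add_commute[of "P" "Q \<oplus> neg P"] flip[of Q P] by simp
          next
            case 2
            have "y2 = l * x2 + m" using L(4) by (simp add: on_line_def)
            then have "y3 = - y2" using y3 unfolding 2 by algebra
            then have "R = neg Q" using L(1,2) N(2) 2 by simp
            then show ?thesis using flip'[of P Q] by simp
          qed
        qed
      qed (use L(3) R in auto)
    qed (use P Q R in auto)
  qed auto
qed

lemma comm_group_ec: "comm_group (ec_group A B)"
proof (rule comm_groupI)
  fix P assume "P \<in> carrier (ec_group A B)"
  then show "\<exists>Q\<in>carrier (ec_group A B). Q \<otimes>\<^bsub>ec_group A B\<^esub> P = \<one>\<^bsub>ec_group A B\<^esub>"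
    by (intro bexI[of _ "neg P"]) (auto simp: ec_group_def)
qed (auto simp: ec_group_def add_closed add_assoc intro: add_commute)

end

section \<open>Independence modulo doubles and 2-torsion\<close>

context comm_group
begin

definition comb :: "('a \<Rightarrow> int) \<Rightarrow> 'a set \<Rightarrow> 'a" where
  "comb c S = finprod G (\<lambda>x. x [^] c x) S"

lemma comb_closed [simp]: "S \<subseteq> carrier G \<Longrightarrow> comb c S \<in> carrier G"
  unfolding comb_def by (rule finprod_closed) auto

lemma comb_empty [simp]: "comb c {} = \<one>"
  by (simp add: comb_def)

lemma comb_insert:
  assumes "finite S" "x \<notin> S" "insert x S \<subseteq> carrier G"
  shows "comb c (insert x S) = x [^] c x \<otimes> comb c S"
  using assms unfolding comb_def by (intro finprod_insert) auto

lemma comb_cong: "(\<And>x. x \<in> S \<Longrightarrow> c x = d x) \<Longrightarrow> S \<subseteq> carrier G \<Longrightarrow> comb c S = comb d S"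
  unfolding comb_def by (rule finprod_cong') auto

lemma comb_add: "S \<subseteq> carrier G \<Longrightarrow> comb (\<lambda>x. c x + d x) S = comb c S \<otimes> comb d S"
  unfolding comb_def
  by (subst finprod_multf[symmetric]) (auto intro!: finprod_cong' simp: int_pow_mult)

lemma comb_pow:
  assumes "finite S" "S \<subseteq> carrier G"
  shows "comb c S [^] (k::int) = comb (\<lambda>x. c x * k) S"
  using assms by (induction S) (simp_all add: comb_insert int_pow_distrib int_pow_pow)

lemma comb_remove:
  assumes "finite S" "S \<subseteq> carrier G" "x \<in> S"
  shows "comb c S = x [^] c x \<otimes> comb c (S - {x})"
  using comb_insert[of "S - {x}" x c] assms by (simp add: insert_absorb subset_iff)

lemma comb_zero: "S \<subseteq> carrier G \<Longrightarrow> (\<And>x. x \<in> S \<Longrightarrow> c x = 0) \<Longrightarrow> comb c S = \<one>"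
  unfolding comb_def by (rule finprod_one_eqI) auto

lemma comb_restrict:
  assumes "finite S" "S \<subseteq> carrier G" "U \<subseteq> S"
  shows "comb c U = comb (\<lambda>x. if x \<in> U then c x else 0) S"
  unfolding comb_def
  by (rule finprod_mono_neutral_cong_left) (use assms in auto)

lemma int_independent_iff:
  "int_independent G S \<longleftrightarrow> finite S \<and> S \<subseteq> carrier G \<and> (\<forall>c. comb c S = \<one> \<longrightarrow> (\<forall>x\<in>S. c x = 0))"
  by (simp add: int_independent_def comb_def)

lemma int_independentD: "int_independent G S \<Longrightarrow> comb c S = \<one> \<Longrightarrow> x \<in> S \<Longrightarrow> c x = 0"
  by (simp add: int_independent_iff)

lemma int_independent_inj:
  assumes S: "int_independent G S" and eq: "comb c S = comb d S" and x: "x \<in> S"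
  shows "c x = d x"
proof -
  have S': "finite S" "S \<subseteq> carrier G" using S by (auto simp: int_independent_iff)
  have "comb (\<lambda>x. c x + d x * (-1)) S = comb c S \<otimes> comb d S [^] (-1::int)"
    using S' by (simp add: comb_add comb_pow del: mult_minus_right mult_minus1_right)
  also have "\<dots> = \<one>" using S' by (simp add: eq int_pow_neg)
  finally have "c x + d x * (-1) = 0" by (rule int_independentD[OF S _ x])
  then show ?thesis by simp
qed

lemma int_independent_subset:
  assumes S: "int_independent G S" and "U \<subseteq> S"
  shows "int_independent G U"
  unfolding int_independent_iff
proof (intro conjI allI impI ballI)
  show "finite U" "U \<subseteq> carrier G" using assms finite_subset by (auto simp: int_independent_iff)
  fix c x assume "comb c U = \<one>" "x \<in> U"
  moreover have "comb c U = comb (\<lambda>x. if x \<in> U then c x else 0) S"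
    using assms by (intro comb_restrict) (auto simp: int_independent_iff)
  ultimately have "comb (\<lambda>x. if x \<in> U then c x else 0) S = \<one>" by simp
  from int_independentD[OF S this, of x] have "(if x \<in> U then c x else 0) = 0"
    using \<open>x \<in> U\<close> \<open>U \<subseteq> S\<close> by blast
  then show "c x = 0" using \<open>x \<in> U\<close> by simp
qed

text \<open>This is the subgroup generated by S and all elements of order dividing 2: doubling both
  sides absorbs the torsion part without naming it.\<close>

definition half_span :: "'a set \<Rightarrow> 'a set" where
  "half_span S = {X \<in> carrier G. \<exists>c. X [^] (2::int) = comb (\<lambda>x. 2 * c x) S}"

lemma subset_half_span:
  assumes "finite S" "S \<subseteq> carrier G"
  shows "S \<subseteq> half_span S"
proof
  fix x assume x: "x \<in> S"
  have "comb (\<lambda>y. 2 * (if y = x then 1 else 0)) S = x [^] (2::int)"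
  proof -
    have "comb (\<lambda>y. 2 * (if y = x then 1 else 0)) (S - {x}) = \<one>"
      using assms by (intro comb_zero) auto
    then show ?thesis using assms x by (subst comb_remove[of _ x]) auto
  qed
  then show "x \<in> half_span S" using assms x unfolding half_span_def by (auto intro!: exI[of _ "\<lambda>y. if y = x then 1 else 0"])
qed

text \<open>Exchanging a member of an independent set for a half of a signed sum (here R with 4 R = 2 \<Sum> e x)
  makes the half span strictly larger.\<close>

lemma exchange:
  assumes S: "int_independent G S" and U: "U \<subseteq> S" "x0 \<in> U"
    and e: "\<And>x. x \<in> U \<Longrightarrow> e x = 1 \<or> e x = (-1::int)"
    and R: "R \<in> carrier G" "R [^] (4::int) = comb (\<lambda>x. 2 * e x) U"
  defines "S' \<equiv> insert R (S - {x0})"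
  shows "R \<notin> half_span S" "card S' = card S" "int_independent G S'" "half_span S \<subseteq> half_span S'"
proof -
  have fin: "finite S" and sub: "S \<subseteq> carrier G" using S by (auto simp: int_independent_iff)
  have subd: "S - {x0} \<subseteq> carrier G" using sub by auto
  have x0: "x0 \<in> S" using U by auto
  define E where "E x = (if x \<in> U then e x else 0)" for x
  have R4: "R [^] (4::int) = comb (\<lambda>x. 2 * E x) S"
    unfolding R(2) comb_restrict[OF fin sub U(1)] by (rule comb_cong) (auto simp: E_def sub)
  have E0: "E x0 * E x0 = 1" using e[OF U(2)] U by (auto simp: E_def)
  show R_notin: "R \<notin> half_span S"
  proof
    assume "R \<in> half_span S"
    then obtain c where c: "R [^] (2::int) = comb (\<lambda>x. 2 * c x) S" by (auto simp: half_span_def)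
    have "R [^] (4::int) = (R [^] (2::int)) [^] (2::int)" using R by (simp add: int_pow_pow)
    also have "\<dots> = comb (\<lambda>x. 2 * c x * 2) S" unfolding c by (rule comb_pow[OF fin sub])
    finally have "2 * E x0 = 2 * c x0 * 2" using int_independent_inj[OF S _ x0] R4 by metis
    then have "E x0 = 2 * c x0" by simp
    then show False using e[OF U(2)] U(2) by (auto simp: E_def) presburger+
  qed
  have Rn: "R \<notin> S - {x0}" using R_notin subset_half_span[OF fin sub] by auto
  show "card S' = card S" unfolding S'_def using Rn fin card_Suc_Diff1[OF fin x0] by simp
  have S': "finite S'" "S' \<subseteq> carrier G" using fin sub R by (auto simp: S'_def)
  have comb_S': "comb c S' = R [^] c R \<otimes> comb c (S - {x0})" for c
    unfolding S'_def using Rn fin sub R by (intro comb_insert) auto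
  have comb_d: "comb c (S - {x0}) = comb (\<lambda>x. if x = x0 then 0 else c x) S" for c
    unfolding comb_restrict[OF fin sub Diff_subset] by (rule comb_cong) (auto simp: sub)
  have R4k: "R [^] (4 * k) = comb (\<lambda>x. 2 * E x * k) S" for k
    using R4 comb_pow[OF fin sub] int_pow_pow[OF R(1)] by metis
  show "int_independent G S'"
    unfolding int_independent_iff
  proof (intro conjI allI impI ballI)
    fix c x assume c: "comb c S' = \<one>" and x: "x \<in> S'"
    \<comment> \<open>The fourth power turns R into a combination of S. There x0 occurs only through
      R, so its coefficient gives c R = 0, after which the others vanish too.\<close>
    have "\<one> = comb c S' [^] (4::int)" using c by simp
    also have "\<dots> = R [^] (4 * c R) \<otimes> comb (\<lambda>x. c x * 4) (S - {x0})"
      using R(1) fin subd by (simp add: comb_S' int_pow_distrib int_pow_pow comb_pow mult.commute)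
    also have "\<dots> = comb (\<lambda>x. 2 * E x * c R + (if x = x0 then 0 else c x * 4)) S"
      using sub by (simp add: R4k comb_d comb_add)
    finally have *: "2 * E y * c R + (if y = x0 then 0 else c y * 4) = 0" if "y \<in> S" for y
      by (intro int_independentD[OF S _ that]) (rule sym)
    have cR: "c R = 0" using *[OF x0] E0 by auto
    then show "c x = 0" using x *[of x] by (auto simp: S'_def)
  qed (use S' in auto)
  show "half_span S \<subseteq> half_span S'"
  proof
    fix X assume "X \<in> half_span S"
    then obtain c where X: "X \<in> carrier G" "X [^] (2::int) = comb (\<lambda>x. 2 * c x) S"
      by (auto simp: half_span_def)
    \<comment> \<open>Up to torsion 2 R = \<Sum> E x, and E x0 is its own inverse, so c x0 copies of
      x0 are 2 k copies of R minus k E x copies of each other x.\<close>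
    define k where "k = E x0 * c x0"
    define d where "d x = (if x = R then 2 * k else c x - E x * k)" for x
    have "comb (\<lambda>x. 2 * d x) S' = R [^] (4 * k) \<otimes> comb (\<lambda>x. 2 * d x) (S - {x0})"
      by (simp add: comb_S' d_def)
    also have "comb (\<lambda>x. 2 * d x) (S - {x0}) = comb (\<lambda>x. 2 * (c x - E x * k)) (S - {x0})"
      using Rn subd by (intro comb_cong) (auto simp: d_def)
    also have "R [^] (4 * k) \<otimes> \<dots> = comb (\<lambda>x. 2 * E x * k + (if x = x0 then 0 else 2 * (c x - E x * k))) S"
      by (simp only: R4k comb_d comb_add[OF sub])
    also have "\<dots> = comb (\<lambda>x. 2 * c x) S"
      using E0 sub by (intro comb_cong) (auto simp: k_def mult.assoc[symmetric])
    finally have "X [^] (2::int) = comb (\<lambda>x. 2 * d x) S'" using X by simp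
    then show "X \<in> half_span S'" using X by (auto simp: half_span_def)
  qed
qed

end

section \<open>Saturation by heights in an abstract group\<close>

locale height_group = comm_group +
  fixes h :: "'a \<Rightarrow> real" and C :: real
  assumes h_parallelogram: "\<And>P Q. P \<in> carrier G \<Longrightarrow> Q \<in> carrier G \<Longrightarrow>
      h (P \<otimes> Q) + h (P \<otimes> inv Q) \<le> 2 * h P + 2 * h Q + C"
    and h_double: "\<And>P. P \<in> carrier G \<Longrightarrow> 4 * h P \<le> h (P \<otimes> P) + C"
    and h_one: "h \<one> = 0"
    and finite_h_le: "\<And>b. finite {P \<in> carrier G. h P \<le> b}"
begin

lemma C_nonneg: "C \<ge> 0"
  using h_parallelogram[of \<one> \<one>] by (simp add: h_one)

text \<open>By the parallelogram inequality the lower of h (s + x) and h (s - x) is at most h s + h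
  x + C / 2, so the sign of each new point can be chosen to make heights merely add up.\<close>

lemma signed_comb_height:
  assumes "finite U" "U \<subseteq> carrier G"
  shows "\<exists>e. (\<forall>x\<in>U. e x = 1 \<or> e x = (-1::int)) \<and> h (comb e U) \<le> (\<Sum>x\<in>U. h x) + card U * (C / 2)"
  using assms
proof (induction U)
  case empty
  then show ?case by (simp add: h_one)
next
  case (insert x U)
  then obtain e where e: "\<forall>x\<in>U. e x = 1 \<or> e x = (-1::int)"
    "h (comb e U) \<le> (\<Sum>x\<in>U. h x) + card U * (C / 2)" by auto
  have x: "x \<in> carrier G" "U \<subseteq> carrier G" using insert by auto
  have c: "comb (e(x := s)) (insert x U) = comb e U \<otimes> x [^] s" for s
  proof -
    have "comb (e(x := s)) U = comb e U" using insert(2) x by (intro comb_cong) auto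
    then show ?thesis using insert(1,2) x by (subst comb_insert) (auto simp: m_comm)
  qed
  have le: "h (comb e U \<otimes> x) + h (comb e U \<otimes> inv x) \<le> 2 * h (comb e U) + 2 * h x + C"
    using x by (intro h_parallelogram) auto
  have "\<exists>s::int. (s = 1 \<or> s = -1) \<and> h (comb e U \<otimes> x [^] s) \<le> h (comb e U) + h x + C / 2"
  proof (cases "h (comb e U \<otimes> x) \<le> h (comb e U) + h x + C / 2")
    case True then show ?thesis using x by (intro exI[of _ "1::int"]) simp
  next
    case False then show ?thesis using x le by (intro exI[of _ "-1"]) (simp add: int_pow_neg)
  qed
  then obtain s :: int where s: "s = 1 \<or> s = -1" "h (comb e U \<otimes> x [^] s) \<le> h (comb e U) + h x + C / 2" by blast
  show ?case
    by (rule exI[of _ "e(x := s)"], unfold c)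
       (use s e insert in \<open>auto simp: algebra_simps add_divide_distrib\<close>)
qed

definition twice_mod_two_torsion :: "'a set" where
  "twice_mod_two_torsion = {R \<otimes> R \<otimes> T | R T. R \<in> carrier G \<and> T \<in> carrier G \<and> T \<otimes> T = \<one>}"

text \<open>With at most three points of height at most B, a half of a signed sum with well-chosen signs has
  height at most 3 B / 4 + O(1), hence again at most B. So a set with the most points of height at
  most B in its half span admits no exchange.\<close>

lemma saturate:
  assumes S: "int_independent G S" "card S \<le> 3"
  obtains S' where "int_independent G S'" "card S' = card S"
    "\<And>U. U \<subseteq> S' \<Longrightarrow> U \<noteq> {} \<Longrightarrow> comb (\<lambda>_. 1) U \<notin> twice_mod_two_torsion"
proof -
  \<comment> \<open>The 4 C absorbs the errors: below, 4 h Q is at most 3 B + 13 C / 4.\<close>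
  define B where "B = Max (insert (4 * C) (h ` S))"
  have fS: "finite S" "S \<subseteq> carrier G" using S by (auto simp: int_independent_iff)
  have B: "4 * C \<le> B" "\<And>x. x \<in> S \<Longrightarrow> h x \<le> B" using fS by (auto simp: B_def)
  define F where "F = {P \<in> carrier G. h P \<le> B}"
  have F: "finite F" unfolding F_def by (rule finite_h_le)
  let ?P = "\<lambda>S'. int_independent G S' \<and> card S' = card S \<and> S' \<subseteq> F"
  let ?f = "\<lambda>S'. card (half_span S' \<inter> F)"
  have PS: "?P S" using S fS B by (auto simp: F_def)
  have "\<forall>S'. ?P S' \<longrightarrow> ?f S' < Suc (card F)" using F by (auto intro: card_mono simp: less_Suc_eq_le)
  from ex_has_greatest_nat[of ?P, OF PS this]
  obtain S1 where S1: "?P S1" and max: "\<And>S'. ?P S' \<Longrightarrow> ?f S' \<le> ?f S1" by blast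
  have f1: "finite S1" "S1 \<subseteq> carrier G" using S1 by (auto simp: int_independent_iff)
  show thesis
  proof (rule that[of S1])
    fix U assume U: "U \<subseteq> S1" "U \<noteq> {}"
    show "comb (\<lambda>_. 1) U \<notin> twice_mod_two_torsion"
    proof
      assume "comb (\<lambda>_. 1) U \<in> twice_mod_two_torsion"
      then obtain R T where RT: "R \<in> carrier G" "T \<in> carrier G" "T \<otimes> T = \<one>"
        "comb (\<lambda>_. 1) U = R \<otimes> R \<otimes> T" by (auto simp: twice_mod_two_torsion_def)
      have fU: "finite U" "U \<subseteq> carrier G" using U f1 finite_subset by auto
      obtain e where e: "\<And>x. x \<in> U \<Longrightarrow> e x = 1 \<or> e x = (-1::int)"
        and he: "h (comb e U) \<le> (\<Sum>x\<in>U. h x) + card U * (C / 2)"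
        using signed_comb_height[OF fU] by blast
      \<comment> \<open>Changing signs alters a sum by twice an element: e x = 1 + 2 ((e x - 1) div
        2). So the signed sum stays a double plus T, with R replaced by Q = R + D.\<close>
      define D where "D = comb (\<lambda>x. (e x - 1) div 2) U"
      have D: "D \<in> carrier G" using fU by (simp add: D_def)
      define Q where "Q = R \<otimes> D"
      have Q: "Q \<in> carrier G" using RT D by (simp add: Q_def)
      have "comb e U = comb (\<lambda>x. 1 + (e x - 1) div 2 * 2) U"
      proof (rule comb_cong)
        show "e x = 1 + (e x - 1) div 2 * 2" if "x \<in> U" for x using e[OF that] by auto
      qed (use fU in auto)
      also have "\<dots> = R \<otimes> R \<otimes> T \<otimes> (D [^] (2::int))"
        using fU by (simp add: comb_add RT comb_pow D_def)
      also have "\<dots> = Q \<otimes> Q \<otimes> T"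
        using RT D int_pow_mult[OF D, of 1 1] by (simp add: Q_def m_ac)
      finally have X: "comb e U = Q \<otimes> Q \<otimes> T" .
      have Xc: "comb e U \<in> carrier G" using fU by simp
      have QQ: "Q \<otimes> Q = comb e U \<otimes> T" using Q RT by (simp add: X m_assoc)
      have invT: "inv T = T" using RT inv_equality by blast
      have "4 * h Q \<le> h (comb e U \<otimes> T) + C" using h_double[OF Q] QQ by simp
      \<comment> \<open>Since T = -T, sum and difference in the parallelogram inequality coincide,
        so it bounds their common height.\<close>
      moreover have "2 * h (comb e U \<otimes> T) \<le> 2 * h (comb e U) + 2 * h T + C"
        using h_parallelogram[OF Xc RT(2)] invT by simp
      moreover have "4 * h T \<le> C" using h_double[OF RT(2)] RT(3) h_one by simp
      moreover have "(\<Sum>x\<in>U. h x) + card U * (C / 2) \<le> (\<Sum>x\<in>U. B + C / 2)"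
      proof -
        have "(\<Sum>x\<in>U. h x) \<le> (\<Sum>x\<in>U. B)" using U S1 by (intro sum_mono) (auto simp: F_def)
        then show ?thesis by (simp add: sum.distrib algebra_simps)
      qed
      moreover have "(\<Sum>x\<in>U. B + C / 2) \<le> 3 * (B + C / 2)"
      proof -
        have "card U \<le> 3" using card_mono[OF f1(1) U(1)] S1 S(2) by simp
        then have "real (card U) * (B + C / 2) \<le> 3 * (B + C / 2)"
          using B(1) C_nonneg by (intro mult_right_mono) auto
        then show ?thesis by (simp only: sum_constant of_nat_eq_iff)
      qed
      ultimately have hQ: "h Q \<le> B" using he B(1) C_nonneg by argo
      obtain x0 where x0: "x0 \<in> U" using U by auto
      have Q4: "Q [^] (4::int) = comb (\<lambda>x. 2 * e x) U"
      proof -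
        have "comb (\<lambda>x. 2 * e x) U = comb e U [^] (2::int)" using fU by (simp add: comb_pow mult.commute)
        also have "\<dots> = (Q [^] (2::int) \<otimes> T) [^] (2::int)" using int_pow_mult[OF Q, of 1 1] Q X by simp
        also have "\<dots> = Q [^] (4::int) \<otimes> T [^] (2::int)" using Q RT by (simp add: int_pow_distrib int_pow_pow)
        also have "T [^] (2::int) = \<one>" using int_pow_mult[OF RT(2), of 1 1] RT by simp
        finally show ?thesis using Q by simp
      qed
      define S2 where "S2 = insert Q (S1 - {x0})"
      have indS1: "int_independent G S1" using S1 by simp
      note ex = exchange[OF indS1 U(1) x0 e Q Q4, folded S2_def]
      have S2F: "S2 \<subseteq> F" using S1 Q hQ by (auto simp: S2_def F_def)
      then have "?f S2 \<le> ?f S1" using max ex S1 by simp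
      moreover have "Q \<in> half_span S2"
        using subset_half_span[of S2] ex(3) by (auto simp: int_independent_iff S2_def)
      then have "half_span S1 \<inter> F \<subset> half_span S2 \<inter> F" using ex(1,4) Q hQ by (auto simp: F_def)
      then have "?f S1 < ?f S2" using F by (intro psubset_card_mono) auto
      ultimately show False by simp
    qed
  qed (use S1 in auto)
qed

end

section \<open>Heights\<close>

text \<open>With the sum of squares instead of the maximum, the height of a pair of rationals is multiplicative:
  (a^2 + b^2) (c^2 + d^2) = (a c - b d)^2 + (a d + b c)^2 depends only on their sum and product.\<close>

definition rat_H :: "rat \<Rightarrow> int" where
  "rat_H x = fst (quotient_of x) ^ 2 + snd (quotient_of x) ^ 2"

lemma rat_H_cases:
  obtains a b where "coprime a b" "b > 0" "x = of_int a / of_int b" "rat_H x = a ^ 2 + b ^ 2"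
proof -
  obtain a b where ab: "quotient_of x = (a, b)" by (cases "quotient_of x")
  show ?thesis
    using that[of a b] ab quotient_of_coprime[OF ab] quotient_of_denom_pos[OF ab] quotient_of_div[OF ab]
    by (simp add: rat_H_def)
qed

lemma of_int_divide_eq_iff:
  assumes "b \<noteq> 0" "d \<noteq> 0"
  shows "(of_int a / of_int b :: rat) = of_int c / of_int d \<longleftrightarrow> a * d = c * b"
proof -
  have "(of_int a / of_int b :: rat) = of_int c / of_int d \<longleftrightarrow> (of_int (a * d) :: rat) = of_int (c * b)"
    using assms by (simp add: frac_eq_eq)
  then show ?thesis by (simp only: of_int_eq_iff)
qed

lemma coprime_fraction_multiple:
  fixes a b c d :: int
  assumes "coprime a b" "b \<noteq> 0" "d \<noteq> 0" "(of_int a / of_int b :: rat) = of_int c / of_int d"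
  obtains k where "k \<noteq> 0" "c = k * a" "d = k * b"
proof -
  have eq: "a * d = c * b" using assms of_int_divide_eq_iff by blast
  then have "b dvd a * d" by simp
  then have "b dvd d" using assms(1) by (simp add: coprime_commute coprime_dvd_mult_right_iff)
  then obtain k where k: "d = b * k" by (auto simp: dvd_def)
  show ?thesis using that[of k] eq k assms by (auto simp: ac_simps)
qed

lemma rat_H_pos: "rat_H x > 0"
  by (cases x rule: rat_H_cases) (simp add: sum_power2_gt_zero_iff)

lemma rat_H_le:
  assumes "b \<noteq> 0" shows "rat_H (of_int a / of_int b) \<le> a ^ 2 + b ^ 2"
proof -
  obtain c d where cd: "coprime c d" "d > 0" "(of_int a / of_int b :: rat) = of_int c / of_int d"
    "rat_H (of_int a / of_int b) = c ^ 2 + d ^ 2" by (rule rat_H_cases)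
  obtain k where k: "k \<noteq> 0" "a = k * c" "b = k * d"
    using coprime_fraction_multiple[of c d b a] cd assms by (metis less_irrefl)
  have "1 * (c ^ 2 + d ^ 2) \<le> k ^ 2 * (c ^ 2 + d ^ 2)"
    using k(1) by (intro mult_right_mono) (auto simp: power2_eq_square int_one_le_iff_zero_less zero_less_mult_iff)
  then show ?thesis using cd(4) k by (simp add: power_mult_distrib algebra_simps)
qed

text \<open>The polynomial (b X - a) (d X - c) = w X^2 - v X + u is primitive by Gauss's lemma, so
  (W, S, Z) is an integer multiple of (w, v, u). Thus any common denominator W may be used:
  cancellation only lowers the bound.\<close>

lemma rat_H_mult_le:
  assumes W: "W \<noteq> 0" and s: "x + y = of_int S / of_int W" and p: "x * y = of_int Z / of_int W"
  shows "rat_H x * rat_H y \<le> (Z - W) ^ 2 + S ^ 2"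
proof -
  obtain a b where x: "coprime a b" "b > 0" "x = of_int a / of_int b" "rat_H x = a ^ 2 + b ^ 2"
    by (rule rat_H_cases)
  obtain c d where y: "coprime c d" "d > 0" "y = of_int c / of_int d" "rat_H y = c ^ 2 + d ^ 2"
    by (rule rat_H_cases)
  define u v w where uvw: "u = a * c" "v = a * d + c * b" "w = b * d"
  have w: "w \<noteq> 0" using x y uvw by simp
  have "x + y = of_int v / of_int w" "x * y = of_int u / of_int w"
    using x y by (simp_all add: uvw add_frac_eq)
  then have vw: "v * W = S * w" and uw: "u * W = Z * w"
    using s p of_int_divide_eq_iff[OF w W] by metis+
  have "coprime (gcd u v) w"
  proof (rule ccontr)
    assume "\<not> coprime (gcd u v) w"
    then have "\<not> is_unit (gcd (gcd u v) w)" "gcd (gcd u v) w \<noteq> 0" using w by (auto simp: coprime_iff_gcd_eq_1)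
    then obtain q where q: "prime q" "q dvd gcd u v" "q dvd w"
      using prime_divisor_exists[of "gcd (gcd u v) w"] by auto
    then have "q dvd a * c" "q dvd a * d + c * b" "q dvd b * d" by (auto simp: uvw)
    moreover have "\<not> (q dvd a \<and> q dvd b)" "\<not> (q dvd c \<and> q dvd d)"
      using x(1) y(1) q(1) by (meson coprime_common_divisor not_prime_unit)+
    ultimately show False using q(1)
      by (smt (verit) dvd_add_right_iff dvd_add_left_iff dvd_mult dvd_mult2 prime_dvd_mult_iff)
  qed
  moreover have "w dvd gcd u v * W"
  proof -
    have "w dvd gcd (u * W) (v * W)" using vw uw by simp
    then show ?thesis by (subst gcd.commute) (simp add: gcd_mult_right)
  qed
  ultimately have "w dvd W" by (simp add: coprime_commute coprime_dvd_mult_right_iff)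
  then obtain k where k: "W = w * k" by (auto simp: dvd_def)
  have "S = v * k" "Z = u * k" using vw uw w k by (auto simp: ac_simps)
  then have "(Z - W) ^ 2 + S ^ 2 = k ^ 2 * ((u - w) ^ 2 + v ^ 2)" unfolding k by (simp add: power2_eq_square algebra_simps)
  also have "(u - w) ^ 2 + v ^ 2 = rat_H x * rat_H y"
    unfolding x(4) y(4) uvw by (simp add: power2_eq_square algebra_simps)
  finally have "(Z - W) ^ 2 + S ^ 2 = k ^ 2 * (rat_H x * rat_H y)" .
  moreover have "1 * (rat_H x * rat_H y) \<le> k ^ 2 * (rat_H x * rat_H y)"
    using rat_H_pos[of x] rat_H_pos[of y] k W
    by (intro mult_right_mono) (auto simp: power2_eq_square int_one_le_iff_zero_less zero_less_mult_iff)
  ultimately show ?thesis by simp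
qed

lemma finite_rat_H_le: "finite {x. rat_H x \<le> m}"
proof (rule finite_subset)
  show "{x. rat_H x \<le> m} \<subseteq> (\<lambda>(a, b). of_int a / of_int b) ` ({-m..m} \<times> {-m..m})"
  proof safe
    fix x assume H: "rat_H x \<le> m"
    obtain a b where ab: "coprime a b" "b > 0" "x = of_int a / of_int b" "rat_H x = a ^ 2 + b ^ 2"
      by (rule rat_H_cases)
    have "\<bar>k\<bar> \<le> k ^ 2" for k :: int
      using self_le_power[of "\<bar>k\<bar>" 2] by (cases "k = 0") auto
    from this[of a] this[of b] have "\<bar>a\<bar> \<le> m" "\<bar>b\<bar> \<le> m" using H ab(4) zero_le_power2[of a] zero_le_power2[of b] by linarith+
    then show "x \<in> (\<lambda>(a, b). of_int a / of_int b) ` ({-m..m} \<times> {-m..m})"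
      using ab(3) by (auto intro!: image_eqI[of _ _ "(a, b)"])
  qed
qed simp

text \<open>Brahmagupta's identity (a^2 + N b^2) (c^2 + N d^2) = (a c \<plusminus> N b d)^2 + N (a d
  \<mp> b c)^2 gives Cauchy-Schwarz; then a^2 + N b^2 is at most N (a^2 + b^2).\<close>

lemma cauchy_bounds:
  fixes a b c d N :: int
  assumes N: "N \<ge> 1"
  defines "X \<equiv> (a ^ 2 + b ^ 2) * (c ^ 2 + d ^ 2)"
  shows "(a * c + N * (b * d)) ^ 2 \<le> N ^ 2 * X" "(a * c - N * (b * d)) ^ 2 \<le> N ^ 2 * X"
proof -
  have 1: "(a * c + e * N * (b * d)) ^ 2 \<le> (a ^ 2 + N * b ^ 2) * (c ^ 2 + N * d ^ 2)" if "e ^ 2 = 1" for e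
  proof -
    have "(a ^ 2 + N * b ^ 2) * (c ^ 2 + N * d ^ 2) - (a * c + e * N * (b * d)) ^ 2 = N * (a * d - e * b * c) ^ 2"
      using that by algebra
    moreover have "N * (a * d - e * b * c) ^ 2 \<ge> 0" using N by simp
    ultimately show ?thesis by linarith
  qed
  have "a ^ 2 + N * b ^ 2 \<le> N * (a ^ 2 + b ^ 2)" "c ^ 2 + N * d ^ 2 \<le> N * (c ^ 2 + d ^ 2)"
    using N by (simp_all add: distrib_left mult_le_cancel_right1)
  then have "(a ^ 2 + N * b ^ 2) * (c ^ 2 + N * d ^ 2) \<le> (N * (a ^ 2 + b ^ 2)) * (N * (c ^ 2 + d ^ 2))"
    using N by (intro mult_mono) auto
  also have "\<dots> = N ^ 2 * X" by (simp add: X_def power2_eq_square)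
  finally have 2: "(a ^ 2 + N * b ^ 2) * (c ^ 2 + N * d ^ 2) \<le> N ^ 2 * X" .
  show "(a * c + N * (b * d)) ^ 2 \<le> N ^ 2 * X" using 1[of 1] 2 by simp
  show "(a * c - N * (b * d)) ^ 2 \<le> N ^ 2 * X" using 1[of "-1"] 2 by simp
qed

section \<open>Height bounds on y^2 = x^3 - p^2 x\<close>

locale congruent_curve =
  fixes p :: int
  assumes p_pos: "p > 0"
begin

definition n :: rat where "n = of_int p"
definition N :: int where "N = p ^ 2"

lemma n_pos: "n > 0" using p_pos by (simp add: n_def)
lemma N_ge: "N \<ge> 1" using p_pos by (simp add: N_def int_one_le_iff_zero_less)
lemma n_sq: "n ^ 2 = of_int N" by (simp add: n_def N_def)

sublocale weierstrass_curve "- (n ^ 2)" 0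
proof
  fix x :: rat assume "x ^ 3 + (- (n ^ 2)) * x + 0 = 0"
  then have "x * (x ^ 2 - n ^ 2) = 0" by (simp add: power2_eq_square power3_eq_cube algebra_simps)
  then have "x ^ 2 = 0 \<or> x ^ 2 = n ^ 2" by auto
  then show "3 * x ^ 2 + (- (n ^ 2)) \<noteq> 0" using n_pos by auto
qed simp

abbreviation padd (infixl "\<oplus>" 65) where "P \<oplus> Q \<equiv> ec_add (- (n ^ 2)) P Q"

fun ht :: "rat ec_point \<Rightarrow> real" where
  "ht Infinity = 0"
| "ht (Point x y) = ln (rat_H x)"

text \<open>The abscissae of P + Q and P - Q involve y1 y2, but their sum and product are rational
  in x1, x2 with denominator (x1 - x2)^2. \<open>S\<close>, \<open>Z\<close>, \<open>W\<close> are
  the numerators and the denominator, homogenised; the two squares in \<open>rat_H_mult_le\<close>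
  contribute 1 + 4 to the factor 5.\<close>

lemma H_add_sub:
  assumes P: "Point x1 y1 \<in> E" "Point x2 y2 \<in> E" and ne: "x1 \<noteq> x2"
    and x3: "Point x1 y1 \<oplus> Point x2 y2 = Point x3 y3" and x4: "Point x1 y1 \<oplus> Point x2 (- y2) = Point x4 y4"
  shows "rat_H x3 * rat_H x4 \<le> 5 * N ^ 4 * (rat_H x1 * rat_H x2) ^ 2"
proof -
  obtain a b where x: "coprime a b" "b > 0" "x1 = of_int a / of_int b" "rat_H x1 = a ^ 2 + b ^ 2"
    by (rule rat_H_cases)
  obtain c d where y: "coprime c d" "d > 0" "x2 = of_int c / of_int d" "rat_H x2 = c ^ 2 + d ^ 2"
    by (rule rat_H_cases)
  define X where "X = (a ^ 2 + b ^ 2) * (c ^ 2 + d ^ 2)"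
  have X0: "X \<ge> 0" by (simp add: X_def)
  define W S Z where W: "W = (a * d - b * c) ^ 2" and S: "S = 2 * (a * d + b * c) * (a * c - N * (b * d))"
    and Z: "Z = (a * c + N * (b * d)) ^ 2"
  define s t where "s = (y2 - y1) / (x2 - x1)" and "t = (- y2 - y1) / (x2 - x1)"
  have st: "s * (x2 - x1) = y2 - y1" "t * (x2 - x1) = - y2 - y1" using ne by (auto simp: s_def t_def)
  have x34: "x3 = s ^ 2 - x1 - x2" "x4 = t ^ 2 - x1 - x2" using x3 x4 ne by (auto simp: s_def t_def Let_def)
  have e: "y1 ^ 2 = x1 ^ 3 - n ^ 2 * x1" "y2 ^ 2 = x2 ^ 3 - n ^ 2 * x2" using P by simp_all
  have 1: "(x3 + x4) * (x1 - x2) ^ 2 = 2 * (x1 + x2) * (x1 * x2 - n ^ 2)" using x34 st e by algebra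
  have 2: "(x3 * x4) * ((x1 - x2) ^ 2) * (x1 - x2) ^ 2 = (x1 * x2 + n ^ 2) ^ 2 * (x1 - x2) ^ 2" using x34 st e by algebra
  have 2: "(x3 * x4) * (x1 - x2) ^ 2 = (x1 * x2 + n ^ 2) ^ 2" using 2 ne by simp
  have bd: "(of_int b :: rat) \<noteq> 0" "(of_int d :: rat) \<noteq> 0" using x y by auto
  have X1: "x1 * of_int b = of_int a" and X2: "x2 * of_int d = of_int c" using x y bd by auto
  have W': "of_int W = (x1 - x2) ^ 2 * (of_int b * of_int d) ^ 2" unfolding W by (simp add: X1[symmetric] X2[symmetric] power2_eq_square algebra_simps)
  have S': "of_int S = 2 * (x1 + x2) * (x1 * x2 - n ^ 2) * (of_int b * of_int d) ^ 2"
    unfolding S by (simp add: X1[symmetric] X2[symmetric] power2_eq_square algebra_simps flip: n_sq)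
  have Z': "of_int Z = (x1 * x2 + n ^ 2) ^ 2 * (of_int b * of_int d) ^ 2"
    unfolding Z by (simp add: X1[symmetric] X2[symmetric] power2_eq_square algebra_simps flip: n_sq)
  have W0: "(of_int W :: rat) \<noteq> 0" using W' ne bd by simp
  have "x3 + x4 = of_int S / of_int W" using W0 1 W' S' by (simp add: eq_divide_eq)
  moreover have "x3 * x4 = of_int Z / of_int W" using W0 2 W' Z' by (simp add: eq_divide_eq)
  ultimately have "rat_H x3 * rat_H x4 \<le> (Z - W) ^ 2 + S ^ 2" using W0 by (intro rat_H_mult_le) auto
  also have "\<dots> \<le> (N ^ 2 * X) ^ 2 + (4 * X * (N ^ 2 * X))"
  proof (rule add_mono)
    have "W \<le> X" using cauchy_bounds(2)[of 1 a d b c] unfolding W X_def by (simp add: algebra_simps)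
    moreover have "Z \<le> N ^ 2 * X" using cauchy_bounds(1)[OF N_ge, of a c b d] unfolding Z X_def by simp
    moreover have "X \<le> N ^ 2 * X" using X0 N_ge by (simp add: mult_le_cancel_right1 one_le_power)
    moreover have "W \<ge> 0" "Z \<ge> 0" by (simp_all add: W Z)
    ultimately show "(Z - W) ^ 2 \<le> (N ^ 2 * X) ^ 2" by (subst abs_le_square_iff[symmetric]) linarith
    have "S ^ 2 = 4 * (a * d + b * c) ^ 2 * (a * c - N * (b * d)) ^ 2"
      unfolding S by (simp only: power_mult_distrib) simp
    also have "\<dots> \<le> (4 * X) * (N ^ 2 * X)"
      using cauchy_bounds(1)[of 1 a d b c] cauchy_bounds(2)[OF N_ge, of a c b d] X0
      by (intro mult_mono) (auto simp: X_def algebra_simps)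
    finally show "S ^ 2 \<le> 4 * X * (N ^ 2 * X)" by simp
  qed
  also have "\<dots> \<le> 5 * N ^ 4 * X ^ 2"
  proof -
    have "N ^ 2 * X ^ 2 \<le> N ^ 4 * X ^ 2" using N_ge by (intro mult_right_mono power_increasing) auto
    then show ?thesis by (simp add: power2_eq_square eval_nat_numeral algebra_simps)
  qed
  finally show ?thesis by (simp add: X_def x(4) y(4))
qed

text \<open>The duplication formula is x' = F / G with quartic forms F, G in a, b. Estimating them
  gives the upper bound. For the lower bound F alone is at least M^2, so only the cancellation in F
  / G has to be limited.\<close>

lemma H_double:
  assumes P: "Point x y \<in> E" and y: "y \<noteq> 0" and x2: "Point x y \<oplus> Point x y = Point x' y'"
  shows "rat_H x' \<le> 5 * N ^ 4 * rat_H x ^ 4" "rat_H x ^ 4 \<le> (16 * N ^ 3) ^ 2 * rat_H x'"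
proof -
  obtain a b where x: "coprime a b" "b > 0" "x = of_int a / of_int b" "rat_H x = a ^ 2 + b ^ 2"
    by (rule rat_H_cases)
  define M where "M = a ^ 2 + b ^ 2"
  define F G where F: "F = (a ^ 2 + N * b ^ 2) ^ 2" and G: "G = 4 * a * b * (a ^ 2 - N * b ^ 2)"
  define s where "s = (3 * x ^ 2 - n ^ 2) / (2 * y)"
  have s: "s * (2 * y) = 3 * x ^ 2 - n ^ 2" using y by (simp add: s_def)
  have x': "x' = s ^ 2 - 2 * x" using x2 y by (auto simp: s_def Let_def)
  have e: "y ^ 2 = x ^ 3 - n ^ 2 * x" using P by simp
  have 1: "x' * (2 * y) ^ 2 = (x ^ 2 + n ^ 2) ^ 2" using x' s e by algebra
  have b: "(of_int b :: rat) \<noteq> 0" using x by auto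
  have X: "x * of_int b = of_int a" using x b by auto
  have F': "of_int F = (x ^ 2 + n ^ 2) ^ 2 * of_int b ^ 4"
    unfolding F by (simp add: X[symmetric] eval_nat_numeral algebra_simps flip: n_sq)
  have G': "of_int G = (2 * y) ^ 2 * of_int b ^ 4"
    unfolding G power_mult_distrib e by (simp add: X[symmetric] eval_nat_numeral algebra_simps flip: n_sq)
  have G0: "G \<noteq> 0" using G' y b by auto
  have FG: "x' = of_int F / of_int G"
  proof -
    have "x' * of_int G = of_int F" unfolding F' G' 1[symmetric] by simp
    then show ?thesis using G0 by (simp add: eq_divide_eq)
  qed
  have M0: "M \<ge> 0" by (simp add: M_def)
  have F_le: "F \<le> N ^ 2 * M ^ 2" and F_ge: "M ^ 2 \<le> F"
  proof -
    have "N * b ^ 2 \<ge> b ^ 2" "N * a ^ 2 \<ge> a ^ 2" using N_ge by (simp_all add: mult_le_cancel_right1)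
    then have "a ^ 2 + N * b ^ 2 \<le> N * M" "M \<le> a ^ 2 + N * b ^ 2" by (simp_all add: M_def distrib_left)
    then show "F \<le> N ^ 2 * M ^ 2" "M ^ 2 \<le> F" using M0 N_ge unfolding F
      by (auto simp flip: power_mult_distrib intro!: power_mono)
  qed
  have G_le: "G ^ 2 \<le> 4 * N ^ 2 * M ^ 4"
  proof -
    have "G ^ 2 = 4 * (a * b + 1 * (b * a)) ^ 2 * (a * a - N * (b * b)) ^ 2" by (simp add: G power2_eq_square algebra_simps)
    also have "\<dots> \<le> (4 * M ^ 2) * (N ^ 2 * M ^ 2)"
    proof (intro mult_mono)
      show "(a * b + 1 * (b * a)) ^ 2 \<le> M ^ 2"
        using cauchy_bounds(1)[of 1 a b b a]
        by (simp only: M_def power2_eq_square[of "a ^ 2 + b ^ 2"] add.commute[of "b ^ 2" "a ^ 2"] power_one mult_1)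
      show "(a * a - N * (b * b)) ^ 2 \<le> N ^ 2 * M ^ 2"
        using cauchy_bounds(2)[OF N_ge, of a a b b] by (simp only: M_def power2_eq_square[of "a ^ 2 + b ^ 2"])
    qed (use M0 in auto)
    finally show ?thesis by (simp add: power2_eq_square eval_nat_numeral algebra_simps)
  qed
  have "rat_H x' \<le> F ^ 2 + G ^ 2" unfolding FG by (rule rat_H_le[OF G0])
  moreover have "F ^ 2 \<le> (N ^ 2 * M ^ 2) ^ 2" using F_le F by (intro power_mono) auto
  moreover have "(N ^ 2 * M ^ 2) ^ 2 = N ^ 4 * M ^ 4" by (simp add: power_mult_distrib flip: power_mult)
  moreover have "N ^ 2 * M ^ 4 \<le> N ^ 4 * M ^ 4" using N_ge by (intro mult_right_mono power_increasing) auto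
  ultimately have "rat_H x' \<le> 5 * N ^ 4 * M ^ 4" using G_le by linarith
  then show "rat_H x' \<le> 5 * N ^ 4 * rat_H x ^ 4" by (simp add: x(4) M_def)
  obtain c d where x'cd: "coprime c d" "d > 0" "x' = of_int c / of_int d" "rat_H x' = c ^ 2 + d ^ 2"
    by (rule rat_H_cases)
  obtain k where k: "k \<noteq> 0" "F = k * c" "G = k * d"
    using coprime_fraction_multiple[of c d G F] x'cd G0 FG by (metis less_irrefl)
  \<comment> \<open>Bezout identities for the forms F and G, found by elimination: a common divisor
    of F and G divides 16 a^7 and 16 N^3 b^7, hence 16 N^3, because a and b are coprime.\<close>
  have "(16 * a ^ 3 - 12 * N * a * b ^ 2) * F + (- 5 * N * a ^ 2 * b - 3 * N ^ 2 * b ^ 3) * G = 16 * a ^ 7"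
    unfolding F G by algebra
  moreover have "(12 * a ^ 2 * b - 16 * N * b ^ 3) * F + (- 3 * a ^ 3 - 5 * N * a * b ^ 2) * G = - 16 * N ^ 3 * b ^ 7"
    unfolding F G by algebra
  ultimately have "k dvd 16 * a ^ 7" "k dvd - 16 * N ^ 3 * b ^ 7" using k by (metis dvd_add dvd_diff dvd_mult dvd_triv_left)+
  then have "k dvd N ^ 3 * (16 * a ^ 7)" "k dvd (16 * N ^ 3) * b ^ 7" by (blast intro: dvd_mult, simp)
  then have "k dvd (16 * N ^ 3) * a ^ 7" "k dvd (16 * N ^ 3) * b ^ 7" by (simp_all add: mult.left_commute mult.assoc)
  then have "k dvd gcd ((16 * N ^ 3) * a ^ 7) ((16 * N ^ 3) * b ^ 7)" by simp
  also have "\<dots> = \<bar>16 * N ^ 3\<bar> * gcd (a ^ 7) (b ^ 7)" by (simp add: gcd_mult_left abs_mult)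
  also have "gcd (a ^ 7) (b ^ 7) = 1" using x(1) by simp
  finally have "k dvd 16 * N ^ 3" by simp
  from dvd_imp_le_int[OF _ this] have "\<bar>k\<bar> \<le> 16 * N ^ 3" using N_ge by simp
  then have "k ^ 2 \<le> (16 * N ^ 3) ^ 2" using power_mono[of "\<bar>k\<bar>" "16 * N ^ 3" 2] by (simp only: abs_ge_zero power2_abs)
  have "M ^ 4 \<le> F ^ 2" using power_mono[OF F_ge, of 2] by (simp flip: power_mult)
  also have "F ^ 2 \<le> k ^ 2 * rat_H x'" unfolding x'cd(4) k(2) by (simp add: power_mult_distrib distrib_left)
  also have "\<dots> \<le> (16 * N ^ 3) ^ 2 * rat_H x'" using \<open>k ^ 2 \<le> _\<close> rat_H_pos[of x'] by (intro mult_right_mono) auto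
  finally show "rat_H x ^ 4 \<le> (16 * N ^ 3) ^ 2 * rat_H x'" by (simp add: x(4) M_def)
qed

text \<open>The summands come from the upper bounds, from the lower bound for doubling, and from the
  torsion abscissae 0, \<plusminus>p, whose doubles are at infinity and have height 0. All are
  nonnegative, so the sum dominates each.\<close>

definition ht_const :: real where
  "ht_const = ln (5 * N ^ 4) + ln ((16 * N ^ 3) ^ 2) + 4 * ln (N + 1)"

lemma ht_const_ge: "ht_const \<ge> ln (5 * N ^ 4)" "ht_const \<ge> ln ((16 * N ^ 3) ^ 2)" "ht_const \<ge> 4 * ln (N + 1)"
  "ht_const \<ge> 0"
proof -
  have "N ^ 4 \<ge> 1" "N ^ 3 \<ge> 1" using N_ge by (simp_all add: one_le_power)
  then have *: "5 * N ^ 4 \<ge> 1" "(16 * N ^ 3) ^ 2 \<ge> 1" "N + 1 \<ge> 1"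
    using N_ge one_le_power[of "16 * N ^ 3" 2] by linarith+
  have "ln (real_of_int k) \<ge> 0" if "k \<ge> 1" for k using that by (intro ln_ge_zero) simp
  from *[THEN this] have "ln (5 * N ^ 4) \<ge> 0" "ln ((16 * N ^ 3) ^ 2) \<ge> 0" "4 * ln (N + 1) \<ge> 0" by simp_all
  then show "ht_const \<ge> ln (5 * N ^ 4)" "ht_const \<ge> ln ((16 * N ^ 3) ^ 2)" "ht_const \<ge> 4 * ln (N + 1)"
    "ht_const \<ge> 0" unfolding ht_const_def by linarith+
qed

lemma ln_le_of_mult_le:
  fixes u v k :: int
  assumes "u \<le> k * v" "u > 0" "v > 0" "k > 0"
  shows "ln (real_of_int u) \<le> ln (real_of_int k) + ln (real_of_int v)"
proof -
  have "ln (real_of_int u) \<le> ln (real_of_int (k * v))" using assms by (intro ln_mono) (auto simp flip: of_int_mult)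
  also have "\<dots> = ln (real_of_int k) + ln (real_of_int v)" using assms by (simp add: ln_mult)
  finally show ?thesis .
qed

lemma ht_neg [simp]: "ht (neg P) = ht P" by (cases P) auto

lemma two_torsion_ht:
  assumes "Point x 0 \<in> ec_points (- (n ^ 2)) 0"
  shows "4 * ht (Point x 0) \<le> ht_const"
proof -
  have "x ^ 3 - n ^ 2 * x = 0" using assms by simp
  then have "x * (x - n) * (x + n) = 0" by (simp add: power2_eq_square power3_eq_cube algebra_simps)
  then have "x = of_int 0 / of_int 1 \<or> x = of_int p / of_int 1 \<or> x = of_int (- p) / of_int 1"
    by (auto simp: n_def add_eq_0_iff)
  then have "rat_H x \<le> N + 1"
    using rat_H_le[of 1 0] rat_H_le[of 1 p] rat_H_le[of 1 "- p"] N_ge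
    by (auto simp: N_def)
  then have "ln (real_of_int (rat_H x)) \<le> ln (real_of_int (N + 1))" using rat_H_pos[of x] by (intro ln_mono) auto
  then show ?thesis using ht_const_ge(3) by simp
qed

lemma ht_double_bounds:
  assumes P: "P \<in> ec_points (- (n ^ 2)) 0"
  shows "ht (P \<oplus> P) \<le> 4 * ht P + ht_const" "4 * ht P \<le> ht (P \<oplus> P) + ht_const"
proof -
  have "ht (P \<oplus> P) \<le> 4 * ht P + ht_const \<and> 4 * ht P \<le> ht (P \<oplus> P) + ht_const"
  proof (cases P)
    case Infinity then show ?thesis using ht_const_ge by simp
  next
    case xy: (Point x y)
    show ?thesis
    proof (cases "y = 0")
      case True
      then show ?thesis using xy two_torsion_ht[of x] P ht_const_ge(4) rat_H_pos[of x]
        by (auto intro!: add_nonneg_nonneg ln_ge_zero)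
    next
      case False
      then obtain x' y' where x': "Point x y \<oplus> Point x y = Point x' y'" by (auto simp: Let_def)
      have Pxy: "Point x y \<in> ec_points (- (n ^ 2)) 0" using P xy by simp
      note H = H_double[OF Pxy False x']
      have "ln (real_of_int (rat_H x')) \<le> ln (real_of_int (5 * N ^ 4)) + ln (real_of_int (rat_H x ^ 4))"
        using H(1) rat_H_pos[of x] rat_H_pos[of x'] N_ge by (intro ln_le_of_mult_le) auto
      moreover have "ln (real_of_int (rat_H x ^ 4)) \<le> ln (real_of_int ((16 * N ^ 3) ^ 2)) + ln (real_of_int (rat_H x'))"
        using H(2) rat_H_pos[of x] rat_H_pos[of x'] N_ge by (intro ln_le_of_mult_le) auto
      moreover have "ln (real_of_int (rat_H x ^ 4)) = 4 * ln (real_of_int (rat_H x))"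
        using rat_H_pos[of x] by (simp add: ln_realpow)
      ultimately show ?thesis using ht_const_ge unfolding xy x' by simp
    qed
  qed
  then show "ht (P \<oplus> P) \<le> 4 * ht P + ht_const" "4 * ht P \<le> ht (P \<oplus> P) + ht_const" by auto
qed

text \<open>Equal abscissae mean Q = \<plusminus>P; one of P + Q, P - Q is then infinity and the
  claim is the upper bound for doubling.\<close>

lemma ht_parallelogram:
  assumes P: "P \<in> ec_points (- (n ^ 2)) 0" and Q: "Q \<in> ec_points (- (n ^ 2)) 0"
  shows "ht (P \<oplus> Q) + ht (P \<oplus> neg Q) \<le> 2 * ht P + 2 * ht Q + ht_const"
proof -
  consider "P = Infinity" | "Q = Infinity" | "Q = P" | "Q = neg P"
    | x1 y1 x2 y2 where "P = Point x1 y1" "Q = Point x2 y2" "x1 \<noteq> x2"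
  proof (cases P)
    case p: (Point x1 y1)
    show thesis
    proof (cases Q)
      case q: (Point x2 y2)
      have "(y1 - y2) * (y1 + y2) = 0" if "x1 = x2"
      proof -
        have "y1 ^ 2 = x1 ^ 3 + - (n ^ 2) * x1 + 0" "y2 ^ 2 = x1 ^ 3 + - (n ^ 2) * x1 + 0"
          using that P Q unfolding p q Point_in_E by simp_all
        then show ?thesis by algebra
      qed
      then have "y2 = y1 \<or> y2 = - y1" if "x1 = x2" using that by (auto simp: add_eq_0_iff)
      then show thesis using p q that by (cases "x1 = x2") auto
    qed (use that in auto)
  qed (use that in auto)
  then show ?thesis
  proof cases
    case 1 then show ?thesis using ht_const_ge by simp
  next
    case 2 then show ?thesis using ht_const_ge by simp
  next
    case 3 then show ?thesis using ht_double_bounds(1)[OF P] by simp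
  next
    case 4 then show ?thesis using ht_double_bounds(1)[OF P] by simp
  next
    case 5
    obtain x3 y3 where x3: "Point x1 y1 \<oplus> Point x2 y2 = Point x3 y3" using 5(3) by (auto simp: Let_def)
    obtain x4 y4 where x4: "Point x1 y1 \<oplus> Point x2 (- y2) = Point x4 y4" using 5(3) by (auto simp: Let_def)
    have "rat_H x3 * rat_H x4 \<le> 5 * N ^ 4 * (rat_H x1 * rat_H x2) ^ 2"
      using H_add_sub[OF _ _ 5(3) x3 x4] P Q 5 by simp
    moreover have "0 < rat_H x3 * rat_H x4" "0 < (rat_H x1 * rat_H x2) ^ 2"
      using rat_H_pos[of x1] rat_H_pos[of x2] rat_H_pos[of x3] rat_H_pos[of x4] by (simp_all add: zero_less_mult_iff)
    ultimately have "ln (real_of_int (rat_H x3 * rat_H x4)) \<le> ln (real_of_int (5 * N ^ 4)) + ln (real_of_int ((rat_H x1 * rat_H x2) ^ 2))"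
      using N_ge by (intro ln_le_of_mult_le) auto
    then show ?thesis using ht_const_ge(1) rat_H_pos[of x1] rat_H_pos[of x2] rat_H_pos[of x3] rat_H_pos[of x4]
      unfolding 5 neg.simps x3 x4 by (simp add: ln_mult ln_realpow del: ec_add.simps)
  qed
qed

lemma finite_ht_le: "finite {P \<in> ec_points (- (n ^ 2)) 0. ht P \<le> b}"
proof (rule finite_subset)
  define X where "X = {x. rat_H x \<le> \<lfloor>exp b\<rfloor>}"
  define Y where "Y x = {y :: rat. y ^ 2 = x ^ 3 - n ^ 2 * x}" for x
  show "{P \<in> ec_points (- (n ^ 2)) 0. ht P \<le> b} \<subseteq> insert Infinity (\<Union>x\<in>X. Point x ` Y x)"
  proof
    fix P assume P: "P \<in> {P \<in> ec_points (- (n ^ 2)) 0. ht P \<le> b}"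
    show "P \<in> insert Infinity (\<Union>x\<in>X. Point x ` Y x)"
    proof (cases P)
      case (Point x y)
      then have "ln (real_of_int (rat_H x)) \<le> b" using P by simp
      then have "real_of_int (rat_H x) \<le> exp b" using rat_H_pos[of x] by (metis exp_le_cancel_iff exp_ln of_int_0_less_iff)
      then have "x \<in> X" by (simp add: X_def le_floor_iff)
      moreover have "y \<in> Y x" using P Point by (simp add: Y_def)
      ultimately show ?thesis using Point by auto
    qed auto
  qed
  have "finite (Y x)" for x
  proof (cases "Y x = {}")
    case False
    then obtain y where "y \<in> Y x" by auto
    then have "z ^ 2 = y ^ 2" if "z \<in> Y x" for z using that by (simp add: Y_def)
    then have "Y x \<subseteq> {y, - y}" unfolding power2_eq_iff by auto
    then show ?thesis by (rule finite_subset) simp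
  qed auto
  then show "finite (insert Infinity (\<Union>x\<in>X. Point x ` Y x))"
    using finite_rat_H_le by (auto simp: X_def)
qed

abbreviation "G \<equiv> ec_group (- (n ^ 2)) 0"

lemma carrier_G: "carrier G = ec_points (- (n ^ 2)) 0" by (simp add: ec_group_def)
lemma mult_G: "P \<otimes>\<^bsub>G\<^esub> Q = P \<oplus> Q" by (simp add: ec_group_def)
lemma one_G: "\<one>\<^bsub>G\<^esub> = Infinity" by (simp add: ec_group_def)

sublocale EG: comm_group G by (rule comm_group_ec)

lemma inv_G: "P \<in> ec_points (- (n ^ 2)) 0 \<Longrightarrow> inv\<^bsub>G\<^esub> P = neg P"
  by (rule EG.inv_equality) (auto simp: carrier_G mult_G one_G)

sublocale EG: height_group G ht ht_const
  by unfold_locales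
    (use ht_parallelogram ht_double_bounds(2) finite_ht_le in \<open>auto simp: carrier_G mult_G one_G inv_G\<close>)

end

section \<open>Square classes of rationals\<close>

lemma rat_square_of_int_imp_square:
  assumes "of_int m = (r :: rat) ^ 2" shows "\<exists>k. m = k ^ 2 \<and> \<bar>r\<bar> = of_int \<bar>k\<bar>"
proof -
  obtain a b where ab: "r = of_int a / of_int b" "b > 0" "coprime a b"
    using quotient_of_div[of r] quotient_of_coprime[of r] quotient_of_denom_pos[of r]
    by (metis prod.exhaust)
  have "(of_int (m * b ^ 2) :: rat) = of_int (a ^ 2)"
    using assms ab by (simp add: power_divide)
  then have eq: "m * b ^ 2 = a ^ 2" by (simp only: of_int_eq_iff)
  then have "b ^ 2 dvd a ^ 2" by (metis dvd_triv_right)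
  then have "b dvd a" by simp
  then have "is_unit b" using ab(3) by (meson coprime_common_divisor dvd_refl)
  then have "b = 1" using ab(2) by simp
  then show ?thesis using eq ab(1) by auto
qed

definition same_class :: "rat \<Rightarrow> rat \<Rightarrow> bool" (infix "\<approx>" 50) where
  "u \<approx> v \<longleftrightarrow> u \<noteq> 0 \<and> v \<noteq> 0 \<and> is_square (u * v)"

lemma same_class_iff: "u \<approx> v \<longleftrightarrow> v \<noteq> 0 \<and> (\<exists>w. w \<noteq> 0 \<and> u = v * w ^ 2)"
proof
  assume "u \<approx> v"
  then obtain w where uv: "u \<noteq> 0" "v \<noteq> 0" "u * v = w ^ 2" by (auto simp: same_class_def is_nth_power_def)
  then have "u = v * (w / v) ^ 2" "w / v \<noteq> 0" by (auto simp: field_simps power2_eq_square)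
  then show "v \<noteq> 0 \<and> (\<exists>w. w \<noteq> 0 \<and> u = v * w ^ 2)" using uv by blast
next
  assume "v \<noteq> 0 \<and> (\<exists>w. w \<noteq> 0 \<and> u = v * w ^ 2)"
  then obtain w where "v \<noteq> 0" "w \<noteq> 0" "u = v * w ^ 2" by blast
  then show "u \<approx> v" by (auto simp: same_class_def is_nth_power_def power2_eq_square intro!: exI[of _ "v * w"])
qed

lemma same_class_refl: "u \<noteq> 0 \<Longrightarrow> u \<approx> u"
  by (auto simp: same_class_def is_nth_power_def power2_eq_square)

lemma same_class_sym: "u \<approx> v \<Longrightarrow> v \<approx> u"
  by (simp add: same_class_def mult.commute)

lemma same_class_trans [trans]: assumes "u \<approx> v" "v \<approx> w" shows "u \<approx> w"
proof -
  obtain a b where "a \<noteq> 0" "b \<noteq> 0" "u = v * a ^ 2" "v = w * b ^ 2" "w \<noteq> 0"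
    using assms by (auto simp: same_class_iff)
  then show ?thesis unfolding same_class_iff by (auto intro!: exI[of _ "b * a"] simp: power_mult_distrib)
qed

lemma same_class_mult: assumes "u \<approx> v" "u' \<approx> v'" shows "u * u' \<approx> v * v'"
proof -
  obtain a b where "a \<noteq> 0" "b \<noteq> 0" "u = v * a ^ 2" "u' = v' * b ^ 2" "v \<noteq> 0" "v' \<noteq> 0"
    using assms by (auto simp: same_class_iff)
  then show ?thesis unfolding same_class_iff by (auto intro!: exI[of _ "a * b"] simp: power_mult_distrib)
qed

lemma same_class_square: "v \<noteq> 0 \<Longrightarrow> w \<noteq> 0 \<Longrightarrow> v * w ^ 2 \<approx> v"
  unfolding same_class_iff by auto

lemma same_class_one_iff: "u \<approx> 1 \<longleftrightarrow> (\<exists>w. w \<noteq> 0 \<and> u = w ^ 2)"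
  by (auto simp: same_class_iff)

lemma same_class_of_int_one: "of_int m \<approx> 1 \<Longrightarrow> is_square m"
  unfolding same_class_one_iff using rat_square_of_int_imp_square by (auto simp: is_nth_power_def)

section \<open>Primes in squarefree parts and in products that are squares\<close>

lemma not_square_prime_mult:
  fixes q m :: int
  assumes "prime q" "\<not> q dvd m" shows "\<not> is_square (q * m)"
proof
  assume "is_square (q * m)"
  then obtain k where k: "q * m = k ^ 2" by (auto simp: is_nth_power_def)
  then have "q dvd k ^ 2" by (metis dvd_triv_left)
  then have "q dvd k" using assms(1) prime_dvd_power by blast
  then obtain j where "k = q * j" by (auto simp: dvd_def)
  then have "q * m = q * (q * j ^ 2)" using k by (simp add: power2_eq_square mult_ac)
  then have "m = q * j ^ 2" using assms(1) by (simp add: prime_gt_0_int)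
  then show False using assms(2) by simp
qed

lemma squarefree_dvd_of_mult_square:
  fixes d v k :: int
  assumes "squarefree d" "d * v = k ^ 2" "prime q" "q dvd d" shows "q dvd v"
proof (rule ccontr)
  assume "\<not> q dvd v"
  obtain d' where d': "d = q * d'" using assms(4) by (auto simp: dvd_def)
  have "\<not> q dvd d'"
  proof
    assume "q dvd d'"
    then have "q ^ 2 dvd d" by (auto simp: d' power2_eq_square)
    then have "is_unit q" using assms(1) squarefreeD by blast
    then show False using assms(3) not_prime_unit by blast
  qed
  then have "\<not> q dvd d' * v" using \<open>\<not> q dvd v\<close> assms(3) prime_dvd_mult_iff by blast
  then have "\<not> is_square (q * (d' * v))" using not_square_prime_mult assms(3) by blast
  then show False using assms(2) by (auto simp: d' mult.assoc)
qed

lemma squarefree_prime_split: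
  fixes d q :: int
  assumes d: "squarefree d" and q: "prime q"
  obtains d' where "d = d' \<or> d = q * d'" "squarefree d'" "\<not> q dvd d'"
proof (cases "q dvd d")
  case False then show ?thesis using that[of d] d by blast
next
  case True
  then obtain d' where d': "d = q * d'" by (auto simp: dvd_def)
  have "\<not> q dvd d'"
  proof
    assume "q dvd d'"
    then have "q ^ 2 dvd d" by (auto simp: d' power2_eq_square)
    then show False using d q squarefreeD not_prime_unit by blast
  qed
  moreover have "squarefree d'" using d squarefree_mono[of d' d] by (simp add: d')
  ultimately show ?thesis using that[of d'] d' by blast
qed

lemma int_unit_of_no_prime_divisor:
  fixes d :: int assumes "d \<noteq> 0" "\<And>q. prime q \<Longrightarrow> \<not> q dvd d" shows "d = 1 \<or> d = - 1"
proof -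
  have "is_unit d" using assms prime_divisor_exists[of d] by blast
  then show ?thesis by (auto simp: abs_if split: if_splits)
qed

lemma coprime_mult_square_int:
  fixes F H w :: int
  assumes "coprime F H" "F > 0" "H > 0" "F * H = w ^ 2"
  shows "is_square F" "is_square H"
proof -
  obtain f h where fh: "F = int f" "H = int h" using assms by (metis nonneg_int_cases less_imp_le)
  have "int (f * h) = int (nat \<bar>w\<bar> ^ 2)" using assms(4) fh by simp
  then have "f * h = nat \<bar>w\<bar> ^ 2" by (simp only: of_nat_eq_iff)
  then have "is_square (f * h)" by (simp only: is_nth_power_nth_power)
  moreover have "coprime f h" using assms(1) fh by simp
  ultimately have "is_square f" "is_square h"
    using is_nth_power_mult_coprime_natD[of f h 2] assms fh by auto
  then show "is_square F" "is_square H" unfolding fh by (auto simp: is_nth_power_def)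
qed

lemma coprime_mult_prime_square:
  fixes F H p w :: int
  assumes "coprime F H" "F > 0" "H > 0" "prime p" "F * H = p * w ^ 2"
  obtains c d where "F = p * c ^ 2 \<and> H = d ^ 2 \<or> H = p * c ^ 2 \<and> F = d ^ 2"
proof -
  have *: "\<exists>c d. F = p * c ^ 2 \<and> H = d ^ 2" if FH: "coprime F H" "F > 0" "H > 0" "F * H = p * w ^ 2" "p dvd F" for F H
  proof -
    obtain F' where F': "F = p * F'" using FH(5) by (auto simp: dvd_def)
    have p0: "p > 0" using assms(4) by (rule prime_gt_0_int)
    have "F' * H = w ^ 2" using FH(4) p0 by (simp add: F')
    moreover have "coprime F' H" using FH(1) by (simp add: F')
    moreover have "F' > 0" using FH(2) p0 by (simp add: F' zero_less_mult_iff)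
    ultimately show ?thesis using coprime_mult_square_int[of F' H w] FH(3) F' by (auto simp: is_nth_power_def)
  qed
  have "p dvd F * H" using assms(5) by simp
  then have "p dvd F \<or> p dvd H" using assms(4) prime_dvd_mult_iff by blast
  then show ?thesis using *[of F H] *[of H F] assms that by (metis coprime_commute mult.commute)
qed

text \<open>The source of the finiteness of the descent: a prime of the squarefree part of u has odd
  order in u, hence in v as well, so it must divide both.\<close>

lemma square_product_squarefree:
  fixes u v k :: int
  assumes "u * v = k ^ 2" "u \<noteq> 0"
  obtains d w where "u = d * w ^ 2" "w \<noteq> 0" "squarefree d" "\<And>q. prime q \<Longrightarrow> q dvd d \<Longrightarrow> q dvd u \<and> q dvd v"
proof -
  define d w where "d = squarefree_part u" and "w = square_part u"
  have u: "u = d * w ^ 2" unfolding d_def w_def by (rule squarefree_decompose)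
  have sq: "squarefree d" by (auto simp: d_def)
  have w: "w \<noteq> 0" using assms(2) u by auto
  have "w ^ 2 dvd k ^ 2" using assms(1) u by (metis dvd_mult2 dvd_triv_right)
  then have "w dvd k" by simp
  then obtain j where "k = w * j" by (auto simp: dvd_def)
  then have "w ^ 2 * (d * v) = w ^ 2 * j ^ 2" using assms(1) u by (simp add: power_mult_distrib mult_ac)
  then have dv: "d * v = j ^ 2" using w by simp
  show thesis
    using that[OF u w sq] squarefree_dvd_of_mult_square[OF sq dv] u by (metis dvd_mult2)
qed

section \<open>Descent\<close>

context weierstrass_curve
begin

text \<open>The value at a root e, where x - e vanishes, is the derivative of the cubic; it has
  the square class of the product of the differences with the other two roots.\<close>

fun root_class :: "'a \<Rightarrow> 'a ec_point \<Rightarrow> 'a" where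
  "root_class e Infinity = 1"
| "root_class e (Point x y) = (if x = e then 3 * e ^ 2 + A else x - e)"

lemma root_class_neg [simp]: "root_class e (neg P) = root_class e P"
  by (cases P) auto

lemma root_class_nonzero:
  assumes "e ^ 3 + A * e + B = 0" shows "root_class e P \<noteq> 0"
  using nonsingular[OF assms] by (cases P) auto

text \<open>A line meeting the curve at abscissa e passes through (e, 0) and is y = l (x - e).
  Dividing the factorisation by x - e and setting x = e gives the derivative there as (x2 - e) (x3 -
  e); nonsingularity keeps x2 and x3 away from e.\<close>

lemma root_class_line_aux:
  assumes e: "e ^ 3 + A * e + B = 0" and L: "on_line l m e y1 x2 y2 x3 y3"
  shows "root_class e (Point e y1) = root_class e (Point x2 y2) * root_class e (Point x3 y3)"
proof -
  have *: "y1 = l * e + m" "l ^ 2 = e + x2 + x3" "A - 2 * l * m = e * x2 + e * x3 + x2 * x3"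
    using L by (auto simp: on_line_def)
  have "y1 ^ 2 = 0" using on_line_imp_point(1)[OF L] e by simp
  then have "l * e + m = 0" using * by simp
  then have m: "m = - l * e" by algebra
  have eq: "3 * e ^ 2 + A = (x2 - e) * (x3 - e)" using *(2,3) m by algebra
  then have "x2 \<noteq> e" "x3 \<noteq> e" using nonsingular[OF e] by auto
  then show ?thesis using eq by simp
qed

text \<open>Away from e, evaluate cubic minus square of the line at x = e: the product of the x_i -
  e is (l e + m)^2. Otherwise the special value at e equals the product of the other two
  classes.\<close>

lemma root_class_line:
  assumes e: "e ^ 3 + A * e + B = 0" and L: "on_line l m x1 y1 x2 y2 x3 y3"
  shows "\<exists>w. root_class e (Point x1 y1) * root_class e (Point x2 y2) * root_class e (Point x3 y3) = w ^ 2"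
proof -
  consider "x1 = e" | "x2 = e" | "x3 = e" | "x1 \<noteq> e" "x2 \<noteq> e" "x3 \<noteq> e" by blast
  then show ?thesis
  proof cases
    case 1
    have "root_class e (Point x1 y1) * root_class e (Point x2 y2) * root_class e (Point x3 y3) = root_class e (Point e y1) ^ 2"
      using root_class_line_aux[OF e] L 1 by (simp only: power2_eq_square mult.assoc)
    then show ?thesis by (rule exI)
  next
    case 2
    have L': "on_line l m e y2 x1 y1 x3 y3" using on_line_swap12[OF L] unfolding 2 .
    have "root_class e (Point x1 y1) * root_class e (Point x2 y2) * root_class e (Point x3 y3) = root_class e (Point e y2) ^ 2"
      using root_class_line_aux[OF e L'] 2 by (simp only: power2_eq_square mult_ac)
    then show ?thesis by (rule exI)
  next
    case 3
    have L': "on_line l m e y3 x1 y1 x2 y2" using on_line_swap12[OF on_line_swap23[OF L]] unfolding 3 .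
    have "root_class e (Point x1 y1) * root_class e (Point x2 y2) * root_class e (Point x3 y3) = root_class e (Point e y3) ^ 2"
      using root_class_line_aux[OF e L'] 3 by (simp only: power2_eq_square mult_ac)
    then show ?thesis by (rule exI)
  next
    case 4
    have *: "l ^ 2 = x1 + x2 + x3" "A - 2 * l * m = x1 * x2 + x1 * x3 + x2 * x3" "m ^ 2 - B = x1 * x2 * x3"
      using L by (auto simp: on_line_def)
    have "(x1 - e) * (x2 - e) * (x3 - e) = (l * e + m) ^ 2" using * e by algebra
    then show ?thesis using 4 by auto
  qed
qed

lemma root_class_add:
  assumes e: "e ^ 3 + A * e + B = 0" and "P \<in> E" "Q \<in> E"
  shows "\<exists>w. root_class e P * root_class e Q * root_class e (P \<oplus> Q) = w ^ 2"
  using assms(2,3)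
proof (cases rule: add_cases)
  case (line l m x1 y1 x2 y2 x3 y3)
  have "root_class e (P \<oplus> Q) = root_class e (Point x3 y3)" by (simp only: line(3) root_class.simps)
  then show ?thesis using root_class_line[OF e line(4)] by (simp only: line(1,2))
next
  case inverse
  show ?thesis by (rule exI[of _ "root_class e P"]) (simp add: inverse power2_eq_square)
next
  case Inf1
  show ?thesis by (rule exI[of _ "root_class e Q"]) (simp add: Inf1 power2_eq_square)
next
  case Inf2
  show ?thesis by (rule exI[of _ "root_class e P"]) (simp add: Inf2 power2_eq_square)
qed

end

section \<open>Square classes at the roots 0 and -p\<close>

locale congruent_prime =
  fixes p :: int
  assumes prime_p: "prime p" and odd_p: "odd p"
begin

sublocale congruent_curve p
  using prime_p by unfold_locales (rule prime_gt_0_int)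

text \<open>\<open>d0\<close> and \<open>d1\<close> determine the class at the third root n, because
  the product of all three is a square.\<close>

definition "d0 = root_class 0"
definition "d1 = root_class (- n)"

lemma d0_simps: "d0 Infinity = 1" "d0 (Point x y) = (if x = 0 then - (n ^ 2) else x)"
  by (simp_all add: d0_def)

lemma d1_simps: "d1 Infinity = 1" "d1 (Point x y) = (if x = - n then 2 * n ^ 2 else x + n)"
  by (simp_all add: d1_def)

lemma d_nonzero: "d0 P \<noteq> 0" "d1 P \<noteq> 0"
  unfolding d0_def d1_def by (rule root_class_nonzero; simp add: power2_eq_square power3_eq_cube)+

lemma d_add:
  assumes "P \<in> E" "Q \<in> E"
  shows "d0 (P \<oplus> Q) \<approx> d0 P * d0 Q" "d1 (P \<oplus> Q) \<approx> d1 P * d1 Q"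
proof -
  have 0: "0 ^ 3 + - n\<^sup>2 * 0 + 0 = 0" "(- n) ^ 3 + - n\<^sup>2 * (- n) + 0 = 0"
    by (simp_all add: power2_eq_square power3_eq_cube)
  show "d0 (P \<oplus> Q) \<approx> d0 P * d0 Q"
    using root_class_add[OF 0(1) assms] d_nonzero
    by (auto simp: same_class_def is_nth_power_def d0_def ac_simps)
  show "d1 (P \<oplus> Q) \<approx> d1 P * d1 Q"
    using root_class_add[OF 0(2) assms] d_nonzero
    by (auto simp: same_class_def is_nth_power_def d1_def ac_simps)
qed

text \<open>kappa and eps list the possible square classes of x + n and of x. The torsion points realise all
  values of eps, so every point has a translate whose abscissa is a square; the class kappa of that
  translate identifies the point modulo doubles and torsion.\<close>

definition kappa :: "bool \<Rightarrow> bool \<Rightarrow> rat" where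
  "kappa i j = (if i then 2 else 1) * (if j then n else 1)"

definition eps :: "bool \<Rightarrow> bool \<Rightarrow> rat" where
  "eps i j = (if i then - 1 else 1) * (if j then n else 1)"

lemma n_nonzero [simp]: "n \<noteq> 0" using n_pos by simp

lemma kappa_nonzero [simp]: "kappa i j \<noteq> 0" and eps_nonzero [simp]: "eps i j \<noteq> 0"
  by (auto simp: kappa_def eps_def)

lemma kappa_mult: "kappa i j * kappa i' j' \<approx> kappa (i \<noteq> i') (j \<noteq> j')"
proof -
  have "kappa i j * kappa i' j' = kappa (i \<noteq> i') (j \<noteq> j') * ((if i \<and> i' then 2 else 1) * (if j \<and> j' then n else 1)) ^ 2"
    by (auto simp: kappa_def power2_eq_square)
  then show ?thesis by (simp only:) (rule same_class_square, auto)
qed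

lemma eps_self: "eps i j * eps i j \<approx> 1"
  unfolding same_class_one_iff by (rule exI[of _ "eps i j"]) (simp add: power2_eq_square)

lemma not_square_n: "\<not> n \<approx> 1" "\<not> 2 \<approx> 1" "\<not> 2 * n \<approx> 1"
proof -
  have "\<not> is_square (p * 1)" using prime_p not_prime_unit by (intro not_square_prime_mult) auto
  then show "\<not> n \<approx> 1" using same_class_of_int_one[of p] by (auto simp: n_def)
  have "\<not> is_square (2 * 1 :: int)" by (intro not_square_prime_mult) auto
  then show "\<not> 2 \<approx> 1" using same_class_of_int_one[of 2] by auto
  have "\<not> is_square (2 * p)" using odd_p by (intro not_square_prime_mult) auto
  then show "\<not> 2 * n \<approx> 1" using same_class_of_int_one[of "2 * p"] by (auto simp: n_def)
qed

lemma kappa_square: "kappa i j \<approx> 1 \<Longrightarrow> \<not> i \<and> \<not> j"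
  using not_square_n by (auto simp: kappa_def split: if_splits)

lemma neg_not_square: "u < 0 \<Longrightarrow> \<not> u \<approx> 1"
  unfolding same_class_one_iff by (metis not_less zero_le_power2)

lemma two_torsion:
  assumes "T \<in> E" "T \<oplus> T = Infinity"
  shows "T \<in> {Infinity, Point 0 0, Point n 0, Point (- n) 0}"
proof (cases T)
  case (Point x y)
  then have y: "y = 0" using assms by (auto simp: Let_def split: if_splits)
  have "x ^ 3 - n ^ 2 * x = 0" using assms Point y by simp
  then have "x * (x - n) * (x + n) = 0" by (simp add: power2_eq_square power3_eq_cube algebra_simps)
  then show ?thesis using Point y by (auto simp: add_eq_0_iff)
qed simp

lemma torsion_in_E: "T \<in> {Infinity, Point 0 0, Point n 0, Point (- n) 0} \<Longrightarrow> T \<in> E \<and> T \<oplus> T = Infinity"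
proof -
  have "n ^ 3 = n ^ 2 * n" by (simp add: power2_eq_square power3_eq_cube)
  then show "T \<in> {Infinity, Point 0 0, Point n 0, Point (- n) 0} \<Longrightarrow> T \<in> E \<and> T \<oplus> T = Infinity"
    by auto
qed

lemma torsion_trivial:
  assumes "T \<in> E" "T \<oplus> T = Infinity" "d0 T \<approx> 1" shows "T = Infinity"
  using two_torsion[OF assms(1,2)] assms(3) not_square_n(1) neg_not_square[of "- (n ^ 2)"] neg_not_square[of "- n"] n_pos
  by (auto simp: d0_simps)

definition normal :: "rat ec_point \<Rightarrow> bool \<Rightarrow> bool \<Rightarrow> bool" where
  "normal P i j \<longleftrightarrow> P \<in> E \<and> d0 P \<approx> 1 \<and> d1 P \<approx> kappa i j"

lemma normal_add:
  assumes "normal P i j" "normal Q i' j'" shows "normal (P \<oplus> Q) (i \<noteq> i') (j \<noteq> j')"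
proof -
  have PQ: "P \<in> E" "Q \<in> E" using assms by (auto simp: normal_def)
  note d_add(1)[OF PQ]
  also have "d0 P * d0 Q \<approx> 1"
    using same_class_mult[of "d0 P" 1 "d0 Q" 1] assms by (simp add: normal_def)
  finally have 1: "d0 (P \<oplus> Q) \<approx> 1" .
  note d_add(2)[OF PQ]
  also have "d1 P * d1 Q \<approx> kappa i j * kappa i' j'"
    using assms by (intro same_class_mult) (auto simp: normal_def)
  also note kappa_mult
  finally show ?thesis using 1 add_closed[OF PQ] by (simp add: normal_def)
qed

lemma torsion_classes:
  "d0 Infinity \<approx> eps False False" "d1 Infinity \<approx> kappa False False"
  "d0 (Point 0 0) \<approx> eps True False" "d1 (Point 0 0) \<approx> kappa False True"
  "d0 (Point n 0) \<approx> eps False True" "d1 (Point n 0) \<approx> kappa True True"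
  "d0 (Point (- n) 0) \<approx> eps True True" "d1 (Point (- n) 0) \<approx> kappa True False"
proof -
  have *: "(- 1) * n ^ 2 \<approx> - 1" "2 * n ^ 2 \<approx> 2" by (rule same_class_square; simp)+
  have "n + n = 2 * n" "n \<noteq> - n" using n_pos by auto
  then show "d0 Infinity \<approx> eps False False" "d1 Infinity \<approx> kappa False False"
    "d0 (Point 0 0) \<approx> eps True False" "d1 (Point 0 0) \<approx> kappa False True"
    "d0 (Point n 0) \<approx> eps False True" "d1 (Point n 0) \<approx> kappa True True"
    "d0 (Point (- n) 0) \<approx> eps True True" "d1 (Point (- n) 0) \<approx> kappa True False"
    using * by (simp_all add: d0_simps d1_simps eps_def kappa_def same_class_refl)
qed

lemma exists_torsion_class:
  obtains T i' j' where "T \<in> E" "T \<oplus> T = Infinity" "d0 T \<approx> eps i j" "d1 T \<approx> kappa i' j'"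
proof -
  have T: "T \<in> E" "T \<oplus> T = Infinity" if "T \<in> {Infinity, Point 0 0, Point n 0, Point (- n) 0}" for T
    using torsion_in_E[OF that] by auto
  consider "\<not> i" "\<not> j" | "i" "\<not> j" | "\<not> i" "j" | "i" "j" by blast
  then show thesis
  proof cases
    case 1 show ?thesis by (rule that[OF T[of Infinity]]) (use 1 torsion_classes in simp_all)
  next
    case 2 show ?thesis by (rule that[OF T[of "Point 0 0"]]) (use 2 torsion_classes in simp_all)
  next
    case 3 show ?thesis by (rule that[OF T[of "Point n 0"]]) (use 3 torsion_classes in simp_all)
  next
    case 4 show ?thesis by (rule that[OF T[of "Point (- n) 0"]]) (use 4 torsion_classes in simp_all)
  qed
qed

text \<open>A prime q of odd order in a b divides (a - p b) (a + p b) too, so by coprimality of a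
  and b it divides p. For x + n the same argument also admits q = 2, since a + p b and a - p b
  differ by 2 p b; negative classes are excluded because the cubic is negative left of -n.\<close>

lemma class_bounds_generic:
  assumes P: "Point x y \<in> E" and y: "y \<noteq> 0"
  shows "\<exists>s k. d0 (Point x y) \<approx> eps s k" "\<exists>i j. d1 (Point x y) \<approx> kappa i j"
proof -
  obtain a b where ab: "x = of_int a / of_int b" "b > 0" "coprime a b"
    using quotient_of_div[of x] quotient_of_coprime[of x] quotient_of_denom_pos[of x]
    by (metis prod.exhaust)
  have b0: "(of_int b :: rat) \<noteq> 0" using ab by simp
  have X: "x * of_int b = of_int a" using ab b0 by simp
  have eq: "y ^ 2 = x ^ 3 - n ^ 2 * x" using P by simp
  have fac: "y ^ 2 = x * (x - n) * (x + n)" using eq by algebra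
  have xne: "x \<noteq> 0" "x \<noteq> n" "x \<noteq> - n" using fac y by auto
  have a0: "a \<noteq> 0" using xne ab by auto
  have "of_int (a * b * ((a - p * b) * (a + p * b))) = (y * of_int b ^ 2) ^ 2"
  proof -
    have "(y * of_int b ^ 2) ^ 2 = y ^ 2 * of_int b ^ 4" by (simp add: power_mult_distrib flip: power_mult)
    also have "\<dots> = (x * of_int b) * of_int b * ((x * of_int b - n * of_int b) * (x * of_int b + n * of_int b))"
      unfolding fac by algebra
    finally show ?thesis by (simp add: X n_def)
  qed
  then obtain k where k: "a * b * ((a - p * b) * (a + p * b)) = k ^ 2"
    using rat_square_of_int_imp_square by blast
  have not_both: False if "prime q" "q dvd a" "q dvd b" for q
    using that ab(3) by (meson coprime_common_divisor not_prime_unit)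
  have class_frac: "of_int u / of_int b \<approx> of_int d" if "u * b = d * w ^ 2" "w \<noteq> 0" "d \<noteq> 0" for u d w
  proof -
    have "of_int u / of_int b = (of_int (u * b) :: rat) / of_int b ^ 2" using b0 by (simp add: power2_eq_square)
    also have "\<dots> = of_int d * (of_int w / of_int b) ^ 2" unfolding that(1) by (simp add: power_divide)
    also have "\<dots> \<approx> of_int d" using that b0 by (intro same_class_square) auto
    finally show ?thesis .
  qed
  show "\<exists>s k. d0 (Point x y) \<approx> eps s k"
  proof -
    obtain d w where d: "a * b = d * w ^ 2" "w \<noteq> 0" "squarefree d"
      "\<And>q. prime q \<Longrightarrow> q dvd d \<Longrightarrow> q dvd a * b \<and> q dvd (a - p * b) * (a + p * b)"
      using square_product_squarefree[OF k] a0 ab(2) by auto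
    have dp: "q = p" if q: "prime q" "q dvd d" for q
    proof -
      have 1: "q dvd a * b" "q dvd (a - p * b) * (a + p * b)" using d(4)[OF q] by auto
      have "q dvd a"
      proof (rule ccontr)
        assume "\<not> q dvd a"
        then have "q dvd b" using 1 q prime_dvd_mult_iff by blast
        moreover have "q dvd a - p * b \<or> q dvd a + p * b" using 1(2) q prime_dvd_mult_iff by blast
        ultimately have "q dvd a" by (metis dvd_add_left_iff dvd_diff_right_iff dvd_mult diff_add_cancel dvd_add)
        with \<open>\<not> q dvd a\<close> show False ..
      qed
      moreover have "q dvd a - p * b \<or> q dvd a + p * b" using 1(2) q prime_dvd_mult_iff by blast
      ultimately have "q dvd p * b" by (metis dvd_add_right_iff dvd_diff_left_iff dvd_diff minus_dvd_iff add_diff_cancel_left' diff_diff_eq2)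
      then have "q dvd p" using not_both[OF q(1) \<open>q dvd a\<close>] q prime_dvd_mult_iff by blast
      then show "q = p" using q prime_p primes_dvd_imp_eq by blast
    qed
    have "d \<noteq> 0" using d(3) by auto
    obtain d' where d': "d = d' \<or> d = p * d'" "squarefree d'" "\<not> p dvd d'"
      using squarefree_prime_split[OF d(3) prime_p] .
    have "d' dvd d" "d' \<noteq> 0" using d' by auto
    then have "d' = 1 \<or> d' = - 1"
      using d'(3) dp by (intro int_unit_of_no_prime_divisor) (auto dest: dvd_trans)
    then have "d \<in> {1, -1, p, - p}" using d'(1) by auto
    moreover have "d0 (Point x y) \<approx> of_int d" using class_frac[OF d(1,2) \<open>d \<noteq> 0\<close>] xne by (simp add: d0_simps ab(1))
    moreover have "of_int 1 = eps False False" "of_int (- 1) = eps True False"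
      "of_int p = eps False True" "of_int (- p) = eps True True" by (simp_all add: eps_def n_def)
    ultimately show ?thesis by (elim insertE emptyE) metis+
  qed
  show "\<exists>i j. d1 (Point x y) \<approx> kappa i j"
  proof -
    have "x + n > 0"
    proof (rule ccontr)
      assume "\<not> x + n > 0"
      then have "x + n < 0" "x < 0" "x - n < 0" using xne n_pos by auto
      then have "x * (x - n) * (x + n) < 0" by (simp add: mult_neg_neg mult_pos_neg)
      then show False unfolding fac[symmetric] by (simp add: not_less flip: not_le)
    qed
    moreover have xn: "x + n = of_int (a + p * b) / of_int b" using b0 by (simp add: ab(1) n_def add_divide_distrib)
    ultimately have "(of_int (a + p * b) :: rat) > 0" using ab(2) by (simp add: zero_less_divide_iff)
    then have apb: "a + p * b > 0" by (simp only: of_int_0_less_iff)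
    have "((a + p * b) * b) * (a * (a - p * b)) = k ^ 2" using k by (simp add: ac_simps)
    then obtain d w where d: "(a + p * b) * b = d * w ^ 2" "w \<noteq> 0" "squarefree d"
      "\<And>q. prime q \<Longrightarrow> q dvd d \<Longrightarrow> q dvd (a + p * b) * b \<and> q dvd a * (a - p * b)"
      using square_product_squarefree[of "(a + p * b) * b"] apb ab(2) by (metis less_irrefl mult_eq_0_iff)
    have dp: "q = p \<or> q = 2" if q: "prime q" "q dvd d" for q
    proof -
      have 1: "q dvd a + p * b \<or> q dvd b" "q dvd a \<or> q dvd a - p * b" using d(4)[OF q] q prime_dvd_mult_iff by blast+
      have nb: "\<not> q dvd b"
      proof
        assume b: "q dvd b"
        then have "q dvd p * b" by simp
        then have "q dvd a" using 1(2) by (metis dvd_add diff_add_cancel)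
        then show False using not_both q b by blast
      qed
      then have apb: "q dvd a + p * b" using 1 by blast
      have "q dvd p * b \<or> q dvd 2 * (p * b)"
        using 1(2)
      proof
        assume "q dvd a" then show ?thesis using apb by (simp add: dvd_add_right_iff)
      next
        assume "q dvd a - p * b"
        then have "q dvd (a + p * b) - (a - p * b)" using apb by (rule dvd_diff[rotated])
        then show ?thesis by (simp add: mult.commute)
      qed
      then have "q dvd p \<or> q dvd 2" using nb q prime_dvd_mult_iff by blast
      then show ?thesis using q prime_p primes_dvd_imp_eq two_is_prime by metis
    qed
    have d0: "d > 0" using d(1,2) apb ab(2) by (smt (verit) mult_pos_pos zero_less_mult_iff zero_less_power2)
    obtain d' where d': "d = d' \<or> d = p * d'" "squarefree d'" "\<not> p dvd d'"
      using squarefree_prime_split[OF d(3) prime_p] .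
    obtain d'' where d'': "d' = d'' \<or> d' = 2 * d''" "squarefree d''" "\<not> 2 dvd d''"
      using squarefree_prime_split[OF d'(2), of 2] by auto
    have "d'' dvd d'" "d' dvd d" "d'' \<noteq> 0" using d' d'' by auto
    then have "d'' = 1 \<or> d'' = - 1"
      using d'(3) d''(3) dp by (intro int_unit_of_no_prime_divisor) (auto dest: dvd_trans)
    then have "d \<in> {1, 2, p, 2 * p}" using d'(1) d''(1) d0 p_pos by auto
    moreover have "d1 (Point x y) \<approx> of_int d" using class_frac[OF d(1,2)] d0 xne by (simp add: d1_simps xn del: of_int_add)
    moreover have "of_int 1 = kappa False False" "of_int 2 = kappa True False"
      "of_int p = kappa False True" "of_int (2 * p) = kappa True True" by (simp_all add: kappa_def n_def)
    ultimately show ?thesis by (elim insertE emptyE) metis+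
  qed
qed

lemma exists_normal_translate:
  assumes P: "P \<in> E"
  obtains T i j where "T \<in> E" "T \<oplus> T = Infinity" "normal (P \<oplus> T) i j"
proof -
  have "\<exists>s k i j. d0 P \<approx> eps s k \<and> d1 P \<approx> kappa i j"
  proof (cases "P \<oplus> P = Infinity")
    case True
    then have "P \<in> {Infinity, Point 0 0, Point n 0, Point (- n) 0}" by (rule two_torsion[OF P])
    then show ?thesis using torsion_classes by auto
  next
    case False
    then obtain x y where xy: "P = Point x y" "y \<noteq> 0" by (cases P) (auto split: if_splits simp: Let_def)
    then show ?thesis using class_bounds_generic[of x y] P by blast
  qed
  then obtain s k i j where c: "d0 P \<approx> eps s k" "d1 P \<approx> kappa i j" by blast
  obtain T i' j' where T: "T \<in> E" "T \<oplus> T = Infinity" "d0 T \<approx> eps s k" "d1 T \<approx> kappa i' j'"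
    by (rule exists_torsion_class)
  note d_add(1)[OF P T(1)]
  also have "d0 P * d0 T \<approx> eps s k * eps s k" by (intro same_class_mult c T)
  also note eps_self
  finally have 0: "d0 (P \<oplus> T) \<approx> 1" .
  note d_add(2)[OF P T(1)]
  also have "d1 P * d1 T \<approx> kappa i j * kappa i' j'" by (intro same_class_mult c T)
  also note kappa_mult
  finally show ?thesis using that[OF T(1,2)] 0 add_closed[OF P T(1)] by (simp add: normal_def)
qed

text \<open>If x = r^2, x - n = s^2, x + n = t^2 with r s t = - y, then a half of (x, y) has abscissa
  r^2 + r s + r t + s t.\<close>

lemma halving:
  assumes "normal P False False" obtains R where "R \<in> E" "P = R \<oplus> R"
proof (cases P)
  case Infinity then show ?thesis using that[of Infinity] by simp
next
  case (Point x y)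
  have P: "y ^ 2 = x ^ 3 - n ^ 2 * x" using assms Point by (simp add: normal_def)
  have d0: "d0 P \<approx> 1" and d1: "d1 P \<approx> 1" using assms by (auto simp: normal_def kappa_def)
  have x0: "x \<noteq> 0" using d0 neg_not_square[of "- (n ^ 2)"] n_pos by (auto simp: Point d0_simps)
  obtain r where r: "r \<noteq> 0" "x = r ^ 2" using d0 x0 by (auto simp: Point d0_simps same_class_one_iff)
  have "x \<noteq> - n" using r n_pos zero_le_power2[of r] by linarith
  then obtain t where t: "t \<noteq> 0" "x + n = t ^ 2" using d1 by (auto simp: Point d1_simps same_class_one_iff)
  \<comment> \<open>Dividing, rather than taking a root of x - n, fixes the sign in r s t = -y; that
    s^2 = x - n then follows from the curve equation.\<close>
  define s where "s = - y / (r * t)"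
  have s: "- y = r * s * t" using r t by (simp add: s_def)
  have "(x - n) * (r ^ 2 * t ^ 2) = s ^ 2 * (r ^ 2 * t ^ 2)"
    using s P r(2) t(2) by algebra
  then have s2: "x - n = s ^ 2" using r t by simp
  \<comment> \<open>Since n = r^2 - s^2 = t^2 - r^2, the factors are a = (r + s) (r + t), a - n = (s
    + r) (s + t) and a + n = (t + r) (t + s), with product b^2. The line below is the tangent at (a,
    -b).\<close>
  define a b where "a = r ^ 2 + r * s + r * t + s * t" and "b = (r + s) * (r + t) * (s + t)"
  have n: "n = r ^ 2 - s ^ 2" "n = t ^ 2 - r ^ 2" using r t s2 by auto
  have rst: "s ^ 2 + t ^ 2 = 2 * r ^ 2" using n by simp
  have n2: "n ^ 2 = (r ^ 2 - s ^ 2) * (t ^ 2 - r ^ 2)"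
    unfolding n(1)[symmetric] n(2)[symmetric] by (rule power2_eq_square)
  have A1: "- (r + s + t) * a + r * (r + s) * (r + t) = - b" unfolding a_def b_def by algebra
  have "on_line (- (r + s + t)) (r * (r + s) * (r + t)) a (- b) a (- b) x (- y)"
    unfolding on_line_def
  proof (intro conjI)
    show "- b = - (r + s + t) * a + r * (r + s) * (r + t)" using A1 ..
    then show "- b = - (r + s + t) * a + r * (r + s) * (r + t)" .
    show "- y = - (r + s + t) * x + r * (r + s) * (r + t)" unfolding s r(2) by algebra
    show "(- (r + s + t)) ^ 2 = a + a + x" unfolding a_def r(2) using rst by algebra
    show "- (n ^ 2) - 2 * - (r + s + t) * (r * (r + s) * (r + t)) = a * a + a * x + a * x"
      unfolding a_def r(2) n2 by algebra
    show "(r * (r + s) * (r + t)) ^ 2 - 0 = a * a * x" unfolding a_def r(2) by algebra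
  qed
  note L = this
  have "Point a (- b) \<oplus> Point a (- b) = Point x y" using add_eq_of_on_line[OF L] by (simp only: minus_minus)
  moreover have "Point a (- b) \<in> E" using on_line_imp_point(1)[OF L] by (simp only: Point_in_E)
  ultimately show ?thesis using that[of "Point a (- b)"] Point by (simp only:)
qed

text \<open>Doubles have trivial classes, so P and T agree in both. The trivial \<open>d0\<close>
  forces T = Infinity, since the other torsion points have classes -1, p, -p; then
  \<open>d1 P\<close> is trivial too.\<close>

lemma normal_class_unique:
  assumes "normal P i j" "R \<in> E" "T \<in> E" "T \<oplus> T = Infinity" "P = R \<oplus> R \<oplus> T"
  shows "\<not> i \<and> \<not> j"
proof -
  have RR: "R \<oplus> R \<in> E" using add_closed assms by blast
  have PT: "d P \<approx> d T" if "\<And>P Q. P \<in> E \<Longrightarrow> Q \<in> E \<Longrightarrow> d (P \<oplus> Q) \<approx> d P * d Q" "\<And>P. d P \<noteq> 0" for d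
  proof -
    have "d P \<approx> d (R \<oplus> R) * d T" unfolding assms(5) by (rule that(1)[OF RR assms(3)])
    also have "\<dots> \<approx> (d R * d R) * d T"
      by (intro same_class_mult that(1) same_class_refl that(2) assms)
    also have "(d R * d R) * d T = d T * (d R) ^ 2" by (simp add: power2_eq_square)
    also have "\<dots> \<approx> d T" by (intro same_class_square that(2))
    finally show ?thesis .
  qed
  note PT = PT[OF d_add(1) d_nonzero(1)] PT[OF d_add(2) d_nonzero(2)]
  have "d0 T \<approx> 1" using PT(1) assms(1) same_class_sym same_class_trans unfolding normal_def by blast
  then have "T = Infinity" using torsion_trivial assms by blast
  then have "d1 P \<approx> 1" using PT(2) by (simp only: d1_simps)
  then have "kappa i j \<approx> 1" using assms(1) same_class_sym same_class_trans unfolding normal_def by blast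
  then show ?thesis by (rule kappa_square)
qed

text \<open>There is no point of order 4: a double has square \<open>d0\<close>, and among the
  2-torsion points only Infinity does.\<close>

lemma double_torsion_trivial:
  assumes "R \<in> E" "(R \<oplus> R) \<oplus> (R \<oplus> R) = Infinity" shows "R \<oplus> R = Infinity"
proof (rule torsion_trivial)
  note d_add(1)[OF assms(1,1)]
  also have "d0 R * d0 R \<approx> 1" using d_nonzero(1)[of R] unfolding same_class_one_iff power2_eq_square by auto
  finally show "d0 (R \<oplus> R) \<approx> 1" .
  show "R \<oplus> R \<in> E" by (intro add_closed assms)
qed (fact assms(2))

end

section \<open>The Pythagorean conditions\<close>

context congruent_prime
begin

lemma rat_fraction: obtains m e where "t = of_int m / (of_int e :: rat)" "e > 0" "coprime m e"
  using quotient_of_div[of t] quotient_of_coprime[of t] quotient_of_denom_pos[of t]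
  by (metis prod.exhaust)

text \<open>As x and x (x - n) (x + n) are squares, x - n shares the class of x + n; it is nonzero
  because n is no square. A nontrivial class excludes Infinity.\<close>

lemma normalD:
  assumes "normal P i j" "i \<or> j"
  obtains r x y where "P = Point x y" "x = r ^ 2" "r \<noteq> 0" "x + n \<approx> kappa i j" "x - n \<approx> kappa i j"
    "x * (x - n) * (x + n) = y ^ 2"
proof (cases P)
  case Infinity
  have "kappa i j \<approx> 1" using assms(1) same_class_sym by (simp add: normal_def Infinity d1_simps)
  then show ?thesis using kappa_square assms(2) by blast
next
  case (Point x y)
  have P: "y ^ 2 = x ^ 3 - n ^ 2 * x" using assms Point by (simp add: normal_def)
  have d0: "d0 P \<approx> 1" and d1: "d1 P \<approx> kappa i j" using assms by (auto simp: normal_def)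
  have x0: "x \<noteq> 0" using d0 neg_not_square[of "- (n ^ 2)"] n_pos by (auto simp: Point d0_simps)
  obtain r where r: "r \<noteq> 0" "x = r ^ 2" using d0 x0 by (auto simp: Point d0_simps same_class_one_iff)
  have xn: "x + n > 0" using r n_pos by (simp add: add_nonneg_pos)
  then have "x \<noteq> - n" by auto
  then have 1: "x + n \<approx> kappa i j" using d1 by (simp add: Point d1_simps)
  have fac: "x * (x - n) * (x + n) = y ^ 2" unfolding P by algebra
  have "x \<noteq> n"
  proof
    assume "x = n"
    then have "n \<approx> 1" using r by (auto simp: same_class_one_iff)
    then show False using not_square_n by blast
  qed
  then have "(x - n) * (x + n) = (y / r) ^ 2" "x - n \<noteq> 0"
    using fac r by (auto simp: power_divide field_simps)
  then have "x - n \<approx> x + n" using xn by (auto simp: same_class_def is_nth_power_def)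
  then show ?thesis using that[OF Point r(2,1) 1 same_class_trans[OF _ 1] fac] by blast
qed

lemma rational_point_of_squares:
  assumes "X \<noteq> 0" "X ^ 2 + n = k * U ^ 2" "X ^ 2 - n = k * V ^ 2" "k = kappa i j"
  shows "normal (Point (X ^ 2) (X * k * U * V)) i j"
proof -
  have "(X * k * U * V) ^ 2 = (X ^ 2) ^ 3 - n ^ 2 * X ^ 2" using assms(2,3) by algebra
  then have E: "Point (X ^ 2) (X * k * U * V) \<in> E" by simp
  have pos: "X ^ 2 + n > 0" using n_pos by (simp add: add_nonneg_pos)
  have "U \<noteq> 0" using pos assms(2) by auto
  then have "X ^ 2 + n \<approx> kappa i j" unfolding assms(2) assms(4) by (intro same_class_square) auto
  moreover have "X ^ 2 \<noteq> - n" using pos by linarith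
  moreover have "X ^ 2 \<approx> 1" using assms(1) by (auto simp: same_class_one_iff)
  ultimately show ?thesis using E assms(1) by (simp add: normal_def d0_simps d1_simps)
qed

text \<open>With t = m / e the beta condition reads 2 X^2 t^2 = t^4 + n^2, that is, X^2 + n and X^2 - n are
  2 ((t + n / t) / 2)^2 and 2 ((t - n / t) / 2)^2.\<close>

lemma beta_imp_normal:
  assumes "beta_minus_Pythagorean p" shows "\<exists>P. normal P True False"
proof -
  obtain a e m u :: int where b: "p * e ^ 2 * m ^ 2 = 2 * a ^ 2 - u ^ 2" "p * e ^ 2 = 2 * a - m ^ 2" "gcd e m = 1"
    using assms by (auto simp: beta_minus_Pythagorean_def)
  \<comment> \<open>Eliminates a through 2 a = p e^2 + m^2; dividing by e^4 gives the quartic in t =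
    m / e.\<close>
  have u: "2 * u ^ 2 = p ^ 2 * e ^ 4 + m ^ 4" using b(1,2) by algebra
  have e0: "e \<noteq> 0"
  proof
    assume "e = 0"
    then have "even (m ^ 4)" using u by (metis add.left_neutral dvd_triv_left mult_zero_right power_eq_0_iff zero_neq_numeral zero_less_numeral power_zero_numeral)
    then show False using b(3) \<open>e = 0\<close> by (auto simp: abs_if split: if_splits)
  qed
  have m0: "m \<noteq> 0"
  proof
    assume "m = 0"
    then have "\<bar>e\<bar> = 1" using b(3) by simp
    then have "e ^ 4 = 1" by (metis power_even_abs_numeral power_one even_numeral)
    then have "2 * u ^ 2 = p ^ 2" using u \<open>m = 0\<close> by simp
    then have "even (p ^ 2)" by (metis dvd_triv_left)
    then show False using odd_p by simp
  qed
  define t where "t = (of_int m / of_int e :: rat)"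
  define X where "X = (of_int u / (of_int e * of_int m) :: rat)"
  have t: "t \<noteq> 0" "t * of_int e = of_int m" using e0 m0 by (simp_all add: t_def)
  have "p ^ 2 * e ^ 4 > 0" using p_pos e0 by simp
  moreover have "m ^ 4 \<ge> 0" by simp
  ultimately have "2 * u ^ 2 > 0" unfolding u by (rule add_pos_nonneg)
  then have u0: "u \<noteq> 0" by auto
  have X0: "X \<noteq> 0" using e0 m0 u0 by (simp add: X_def)
  have "(of_int (2 * u ^ 2) :: rat) = of_int (p ^ 2 * e ^ 4 + m ^ 4)" using u by (simp only:)
  then have ur: "2 * of_int u ^ 2 = n ^ 2 * of_int e ^ 4 + (of_int m :: rat) ^ 4" by (simp add: n_def)
  have Xe: "X * (of_int e * of_int m) = of_int u" using e0 m0 by (simp add: X_def)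
  have "(2 * X ^ 2 * t ^ 2 - (t ^ 4 + n ^ 2)) * of_int e ^ 4 = 0"
    using ur Xe t(2) by algebra
  then have Xt: "2 * X ^ 2 * t ^ 2 = t ^ 4 + n ^ 2" using e0 by simp
  define q where "q = n / t"
  have q: "n = t * q" using t(1) by (simp add: q_def)
  have "t ^ 2 * (2 * X ^ 2) = t ^ 2 * (t ^ 2 + q ^ 2)" using Xt q by algebra
  then have "2 * X ^ 2 = t ^ 2 + q ^ 2" using t(1) by simp
  then have X2: "X ^ 2 = (t ^ 2 + q ^ 2) / 2" by simp
  have "normal (Point (X ^ 2) (X * 2 * ((t + q) / 2) * ((t - q) / 2))) True False"
  proof (rule rational_point_of_squares[OF X0])
    show "X ^ 2 + n = 2 * ((t + q) / 2) ^ 2" "X ^ 2 - n = 2 * ((t - q) / 2) ^ 2"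
      unfolding X2 q by (simp_all add: power2_eq_square field_simps)
  qed (simp add: kappa_def)
  then show ?thesis ..
qed

text \<open>Since s^2 - v^2 = n, the sum t = s + v has n / t = s - v, which inverts the substitution
  used for the converse. With t = m / e in lowest terms, m^4 + p^2 e^4 = 2 u^2; as p is odd, p e^2 +
  m^2 is then even, which makes a an integer.\<close>

lemma normal_imp_beta:
  assumes "normal P True False" shows "beta_minus_Pythagorean p"
proof -
  obtain r x y where x: "x = r ^ 2" "r \<noteq> 0" "x + n \<approx> kappa True False" "x - n \<approx> kappa True False"
    using normalD[OF assms] by metis
  then obtain s v where s: "r ^ 2 + n = 2 * s ^ 2" "r ^ 2 - n = 2 * v ^ 2"
    by (auto simp: same_class_iff kappa_def)
  define t where "t = s + v"
  have tn: "t * (s - v) = n" using s unfolding t_def by algebra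
  then have t0: "t \<noteq> 0" by auto
  have rt: "2 * r ^ 2 * t ^ 2 = t ^ 4 + n ^ 2" using s t_def tn by algebra
  obtain m e where me: "t = of_int m / of_int e" "e > 0" "coprime m e" by (rule rat_fraction)
  have te: "t * of_int e = of_int m" using me by simp
  have "of_int (2 * (m ^ 4 + p ^ 2 * e ^ 4)) = (2 * (r * of_int m * of_int e)) ^ 2"
    using rt te by (simp add: n_def) algebra
  then obtain k where k: "2 * (m ^ 4 + p ^ 2 * e ^ 4) = k ^ 2"
    using rat_square_of_int_imp_square by blast
  then have "even (k ^ 2)" by (metis dvd_triv_left)
  then obtain u where u: "k = 2 * u" by (auto elim: evenE)
  have mu: "m ^ 4 + p ^ 2 * e ^ 4 = 2 * u ^ 2" using k by (simp add: u power_mult_distrib)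
  then have "even (m ^ 4 + p ^ 2 * e ^ 4)" by simp
  then have "even (p * e ^ 2 + m ^ 2)" using odd_p by (auto simp: even_add)
  then obtain a where a: "p * e ^ 2 + m ^ 2 = 2 * a" by (elim evenE)
  have "2 * (p * e ^ 2 * m ^ 2) = 2 * (2 * a ^ 2 - u ^ 2)" using mu a by algebra
  then have "p * e ^ 2 * m ^ 2 = 2 * a ^ 2 - u ^ 2" by simp
  moreover have "p * e ^ 2 = 2 * a - m ^ 2" using a by simp
  moreover have "gcd e m = 1" using me(3) by (simp add: coprime_iff_gcd_eq_1 gcd.commute)
  ultimately show ?thesis unfolding beta_minus_Pythagorean_def by (intro exI conjI)
qed

text \<open>With a / b = t + 1, the forms a^2 + b^2 and (a - 2 b)^2 + b^2 become the two factors of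
  t^4 + 4 = (t^2 + 2 t + 2) (t^2 - 2 t + 2), so that n z^2 = t^4 + 4 for a rational z; the point has
  abscissa (n z / (2 t))^2.\<close>

lemma alpha_imp_normal_aux:
  fixes a b c d :: int
  assumes g: "Gcd {a, b, c} = 1" and c: "p * c ^ 2 = a ^ 2 + b ^ 2" and d: "(a - 2 * b) ^ 2 + b ^ 2 = d ^ 2"
  shows "\<exists>P. normal P False True"
proof -
  have nsq: "z = 0" if "p * w ^ 2 = z ^ 2" for z w :: int
  proof (rule ccontr)
    assume z: "z \<noteq> 0"
    then have w: "w \<noteq> 0" using that by auto
    have "is_square (p * w ^ 2)" unfolding that by simp
    then have "is_square p" using is_nth_power_mult_cancel_right[of 2 "w ^ 2" p] w by simp
    then show False using not_square_prime_mult[of p 1] prime_p not_prime_unit by auto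
  qed
  have b0: "b \<noteq> 0"
  proof
    assume "b = 0"
    then have "a = 0" using nsq[of c a] c by simp
    then have "c = 0" using c \<open>b = 0\<close> p_pos by simp
    then show False using g \<open>a = 0\<close> \<open>b = 0\<close> by simp
  qed
  have ab: "a \<noteq> b"
  proof
    assume "a = b"
    then have *: "p * c ^ 2 = 2 * a ^ 2" using c by simp
    have "p * (2 * c ^ 2) = (2 * a) ^ 2" using * by (simp add: power_mult_distrib)
    then have "is_square (2 * p * c ^ 2)" by (metis is_nth_powerI mult.assoc mult.left_commute)
    moreover have "c \<noteq> 0" using * b0 \<open>a = b\<close> by auto
    ultimately have "is_square (2 * p)" using is_nth_power_mult_cancel_right[of 2 "c ^ 2" "2 * p"] by simp
    then show False using not_square_prime_mult[of 2 p] odd_p by auto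
  qed
  define t where "t = (of_int (a - b) / of_int b :: rat)"
  define z where "z = (of_int c * of_int d / of_int b ^ 2 :: rat)"
  have t0: "t \<noteq> 0" and tb: "t * of_int b = of_int a - of_int b" using ab b0 by (simp_all add: t_def)
  have zb: "z * of_int b ^ 2 = of_int c * of_int d" using b0 by (simp add: z_def)
  have "(of_int (p * c ^ 2) :: rat) = of_int (a ^ 2 + b ^ 2)" using c by (simp only:)
  then have cr: "n * of_int c ^ 2 = of_int a ^ 2 + (of_int b :: rat) ^ 2" by (simp add: n_def)
  have "(of_int ((a - 2 * b) ^ 2 + b ^ 2) :: rat) = of_int (d ^ 2)" using d by (simp only:)
  then have dr: "(of_int a - 2 * of_int b) ^ 2 + of_int b ^ 2 = (of_int d :: rat) ^ 2" by simp
  have "(n * z ^ 2 - (t ^ 4 + 4)) * of_int b ^ 4 = (n * of_int c ^ 2) * of_int d ^ 2 - ((t * of_int b) ^ 4 + 4 * of_int b ^ 4)"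
    using zb by algebra
  also have "\<dots> = 0" unfolding tb cr dr[symmetric] by algebra
  finally have zt: "n * z ^ 2 = t ^ 4 + 4" using b0 by simp
  have z0: "z \<noteq> 0"
  proof
    assume "z = 0"
    then have "t ^ 4 + 4 = 0" using zt by simp
    moreover have "t ^ 4 \<ge> 0" by simp
    ultimately show False by linarith
  qed
  define X where "X = n * z / (2 * t)"
  have "normal (Point (X ^ 2) (X * n * ((t ^ 2 + 2) / (2 * t)) * ((t ^ 2 - 2) / (2 * t)))) False True"
  proof (rule rational_point_of_squares)
    show "X \<noteq> 0" using z0 t0 by (simp add: X_def)
    have "X ^ 2 = n * (n * z ^ 2) / (2 * t) ^ 2" by (simp add: X_def power_divide power_mult_distrib power2_eq_square mult_ac)
    then have X: "X ^ 2 = n * (t ^ 4 + 4) / (2 * t) ^ 2" unfolding zt .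
    show "X ^ 2 + n = n * ((t ^ 2 + 2) / (2 * t)) ^ 2" "X ^ 2 - n = n * ((t ^ 2 - 2) / (2 * t)) ^ 2"
      unfolding X using t0 by (simp_all add: field_simps eval_nat_numeral)
  qed (simp add: kappa_def)
  then show ?thesis ..
qed

lemma alpha_imp_normal:
  assumes "alpha_minus_pm_Pythagorean p" shows "\<exists>P. normal P False True"
proof -
  have "\<exists>a b c d :: int. Gcd {a, b, c} = 1 \<and> p * c ^ 2 = a ^ 2 + b ^ 2 \<and> (a - 2 * b) ^ 2 + b ^ 2 = d ^ 2"
    using assms unfolding alpha_minus_pm_Pythagorean_def
  proof
    assume "alpha_minus_minus_Pythagorean p"
    then show ?thesis unfolding alpha_minus_minus_Pythagorean_def is_nth_power_def by metis
  next
    assume "alpha_minus_plus_Pythagorean p"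
    then obtain a b c d :: int where "Gcd {a, b, c} = 1" "p * c ^ 2 = a ^ 2 + b ^ 2" "(a + 2 * b) ^ 2 + b ^ 2 = d ^ 2"
      unfolding alpha_minus_plus_Pythagorean_def is_nth_power_def by metis
    then show ?thesis by (intro exI[of _ a] exI[of _ "- b"] exI[of _ c] exI[of _ d]) simp
  qed
  then show ?thesis using alpha_imp_normal_aux by blast
qed

text \<open>Sophie Germain's identity splits the left side into F H. For odd m the factors are
  coprime, so one is p times a square and the other a square; which one carries p decides between
  the two signs of the alpha condition.\<close>

lemma alpha_of_sum_of_fourth_powers:
  fixes m k w :: int
  assumes cop: "coprime m k" and m: "odd m" and eq: "m ^ 4 + 4 * k ^ 4 = p * w ^ 2"
  shows "alpha_minus_pm_Pythagorean p"
proof -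
  define F H where "F = (m + k) ^ 2 + k ^ 2" and "H = (m - k) ^ 2 + k ^ 2"
  have odd: "odd F" "odd H" using m by (simp_all add: F_def H_def)
  have "F \<noteq> 0" "H \<noteq> 0" using odd by auto
  then have pos: "F > 0" "H > 0" by (auto simp: F_def H_def sum_power2_gt_zero_iff simp flip: sum_power2_eq_zero_iff)
  have "coprime F H"
  proof (rule ccontr)
    assume "\<not> coprime F H"
    then have "\<not> is_unit (gcd F H)" "gcd F H \<noteq> 0" using pos by (auto simp: coprime_iff_gcd_eq_1)
    then obtain q where q: "prime q" "q dvd F" "q dvd H" using prime_divisor_exists[of "gcd F H"] by auto
    have "q \<noteq> 2" using odd q by auto
    have "q dvd F - H" using q by auto
    have "F - H = 2 * 2 * (m * k)" by (simp add: F_def H_def power2_eq_square algebra_simps)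
    then have "q dvd 2 * 2 * (m * k)" using \<open>q dvd F - H\<close> by simp
    then have "q dvd 2 \<or> q dvd m \<or> q dvd k" using q(1) prime_dvd_mult_iff by blast
    moreover have "\<not> q dvd 2" using q(1) \<open>q \<noteq> 2\<close> primes_dvd_imp_eq two_is_prime by metis
    ultimately have mk: "q dvd m \<or> q dvd k" by blast
    have F: "F = m * (m + 2 * k) + 2 * k * k" by (simp add: F_def power2_eq_square algebra_simps)
    from mk have "q dvd m \<and> q dvd k"
    proof
      assume qm: "q dvd m"
      then have "q dvd 2 * k * k" using q(2) unfolding F by (simp add: dvd_add_right_iff)
      then show ?thesis using q(1) \<open>\<not> q dvd 2\<close> qm prime_dvd_mult_iff by blast
    next
      assume qk: "q dvd k"
      then have "q dvd m * (m + 2 * k)" using q(2) unfolding F by (simp add: dvd_add_left_iff)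
      then have "q dvd m \<or> q dvd m + 2 * k" using q(1) prime_dvd_mult_iff by blast
      then show ?thesis using qk by (auto simp: dvd_add_left_iff)
    qed
    then show False using cop q(1) by (meson coprime_common_divisor not_prime_unit)
  qed
  moreover have "F * H = p * w ^ 2" unfolding F_def H_def eq[symmetric] by algebra
  ultimately obtain c d where cd: "F = p * c ^ 2 \<and> H = d ^ 2 \<or> H = p * c ^ 2 \<and> F = d ^ 2"
    using coprime_mult_prime_square[OF _ pos prime_p] by blast
  have g: "Gcd {m + k, k, c} = 1" "Gcd {m - k, k, c} = 1"
    using cop by (simp_all add: coprime_iff_gcd_eq_1 gcd_diff1 flip: gcd.assoc)
  from cd show ?thesis
  proof
    assume "F = p * c ^ 2 \<and> H = d ^ 2"
    then have "alpha_minus_minus_Pythagorean p"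
      unfolding alpha_minus_minus_Pythagorean_def is_nth_power_def F_def H_def using g(1)
      by (intro exI[of _ "m + k"] exI[of _ k] exI[of _ c]) (auto intro!: exI[of _ d] simp: algebra_simps)
    then show ?thesis by (simp add: alpha_minus_pm_Pythagorean_def)
  next
    assume "H = p * c ^ 2 \<and> F = d ^ 2"
    then have "alpha_minus_plus_Pythagorean p"
      unfolding alpha_minus_plus_Pythagorean_def is_nth_power_def F_def H_def using g(2)
      by (intro exI[of _ "m - k"] exI[of _ k] exI[of _ c]) (auto intro!: exI[of _ d] simp: algebra_simps)
    then show ?thesis by (simp add: alpha_minus_pm_Pythagorean_def)
  qed
qed

text \<open>Here s^2 - v^2 = 2, so t = s + v satisfies s - v = 2 / t and 4 r^2 t^2 = n (t^4 + 4).
  Clearing denominators gives the sum of fourth powers treated before.\<close>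

lemma normal_imp_alpha:
  assumes "normal P False True" shows "alpha_minus_pm_Pythagorean p"
proof -
  obtain r x y where x: "x = r ^ 2" "r \<noteq> 0" "x + n \<approx> kappa False True" "x - n \<approx> kappa False True"
    using normalD[OF assms] by metis
  then obtain s v where s: "r ^ 2 + n = n * s ^ 2" "r ^ 2 - n = n * v ^ 2"
    by (auto simp: same_class_iff kappa_def)
  define t where "t = s + v"
  have "n * (t * (s - v)) = n * 2" using s unfolding t_def by algebra
  then have tn: "t * (s - v) = 2" by simp
  then have t0: "t \<noteq> 0" by auto
  have rt: "4 * r ^ 2 * t ^ 2 = n * (t ^ 4 + 4)" using s t_def tn by algebra
  obtain m k where mk: "t = of_int m / of_int k" "k > 0" "coprime m k" by (rule rat_fraction)
  have tk: "t * of_int k = of_int m" using mk by simp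
  have "of_int (p * (m ^ 4 + 4 * k ^ 4)) = (2 * r * of_int m * of_int k) ^ 2"
    using rt tk by (simp add: n_def) algebra
  then obtain w0 where w0: "p * (m ^ 4 + 4 * k ^ 4) = w0 ^ 2"
    using rat_square_of_int_imp_square by blast
  then have "p dvd w0" using prime_p prime_dvd_power by (metis dvd_triv_left)
  then obtain w where w: "w0 = p * w" by (auto simp: dvd_def)
  have "p * (m ^ 4 + 4 * k ^ 4) = p * (p * w ^ 2)" using w0 by (simp add: w power2_eq_square mult_ac)
  then have eq: "m ^ 4 + 4 * k ^ 4 = p * w ^ 2" using p_pos by simp
  show ?thesis
  proof (cases "odd m")
    case True
    then show ?thesis using alpha_of_sum_of_fourth_powers mk(3) eq by blast
  next
    \<comment> \<open>The passage from t to 2 / t: for m = 2 m' the equation is divisible by 4, and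
      the odd k takes over the role of m.\<close>
    case False
    then have "even m" by simp
    then obtain m' where m': "m = 2 * m'" by (elim evenE)
    have "odd k" using False mk(3) by (meson coprime_common_divisor not_prime_unit two_is_prime)
    have "even (p * w ^ 2)" unfolding eq[symmetric] m' by simp
    then have "even w" using odd_p by simp
    then obtain w' where w': "w = 2 * w'" by (elim evenE)
    have "4 * (k ^ 4 + 4 * m' ^ 4) = 4 * (p * w' ^ 2)" using eq unfolding m' w' by (simp add: power_mult_distrib)
    then have "k ^ 4 + 4 * m' ^ 4 = p * w' ^ 2" by simp
    moreover have "coprime k m'" using mk(3) by (simp add: m' coprime_commute)
    ultimately show ?thesis using alpha_of_sum_of_fourth_powers \<open>odd k\<close> by blast
  qed
qed

end

section \<open>The rank\<close>

context congruent_prime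
begin

text \<open>The class of P modulo 2 E + E[2], as a relation so that no particular translate has to
  be chosen.\<close>

definition attains :: "rat ec_point \<Rightarrow> bool \<Rightarrow> bool \<Rightarrow> bool" where
  "attains P i j \<longleftrightarrow> P \<in> E \<and> (\<exists>T\<in>E. T \<oplus> T = Infinity \<and> normal (P \<oplus> T) i j)"

lemma add_add_swap:
  assumes "P \<in> E" "Q \<in> E" "R \<in> E" "S \<in> E"
  shows "(P \<oplus> Q) \<oplus> (R \<oplus> S) = (P \<oplus> R) \<oplus> (Q \<oplus> S)"
proof -
  have "P \<otimes>\<^bsub>G\<^esub> Q \<otimes>\<^bsub>G\<^esub> (R \<otimes>\<^bsub>G\<^esub> S) = P \<otimes>\<^bsub>G\<^esub> R \<otimes>\<^bsub>G\<^esub> (Q \<otimes>\<^bsub>G\<^esub> S)"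
    using assms[folded carrier_G] by (simp add: EG.m_ac)
  then show ?thesis by (simp only: mult_G)
qed

lemma attains_add:
  assumes "attains P i j" "attains Q i' j'" shows "attains (P \<oplus> Q) (i \<noteq> i') (j \<noteq> j')"
proof -
  obtain T T' where T: "P \<in> E" "T \<in> E" "T \<oplus> T = Infinity" "normal (P \<oplus> T) i j"
    "Q \<in> E" "T' \<in> E" "T' \<oplus> T' = Infinity" "normal (Q \<oplus> T') i' j'"
    using assms by (auto simp: attains_def)
  have "normal ((P \<oplus> Q) \<oplus> (T \<oplus> T')) (i \<noteq> i') (j \<noteq> j')"
    using normal_add[OF T(4,8)] add_add_swap[of P T Q T'] T by simp
  moreover have "(T \<oplus> T') \<oplus> (T \<oplus> T') = Infinity" using add_add_swap[of T T' T T'] T by simp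
  ultimately show ?thesis using T add_closed unfolding attains_def by blast
qed

lemma exists_attains: assumes "P \<in> E" shows "\<exists>i j. attains P i j"
  using exists_normal_translate[OF assms] assms unfolding attains_def by metis

lemma twice_iff:
  "P \<in> EG.twice_mod_two_torsion \<longleftrightarrow> (\<exists>R\<in>E. \<exists>T\<in>E. T \<oplus> T = Infinity \<and> P = (R \<oplus> R) \<oplus> T)"
  unfolding EG.twice_mod_two_torsion_def mult_G one_G carrier_G by blast

text \<open>Together with \<open>normal_twice\<close>, this makes the class a faithful invariant
  modulo doubles and 2-torsion.\<close>

lemma attains_zero:
  assumes "attains P False False" shows "P \<in> EG.twice_mod_two_torsion"
proof -
  obtain T where T: "P \<in> E" "T \<in> E" "T \<oplus> T = Infinity" "normal (P \<oplus> T) False False"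
    using assms by (auto simp: attains_def)
  obtain R where R: "R \<in> E" "P \<oplus> T = R \<oplus> R" using halving[OF T(4)] .
  have "(R \<oplus> R) \<oplus> T = P" using add_assoc[of P T T] T by (simp flip: R(2))
  then show ?thesis using T R unfolding twice_iff by blast
qed

lemma normal_twice: "normal P i j \<Longrightarrow> P \<in> EG.twice_mod_two_torsion \<Longrightarrow> \<not> i \<and> \<not> j"
  unfolding twice_iff using normal_class_unique by blast

lemma comb_singleton: "a \<in> E \<Longrightarrow> EG.comb (\<lambda>_. 1) {a} = a"
  by (simp add: EG.comb_insert flip: carrier_G)

lemma comb_pair: "a \<in> E \<Longrightarrow> b \<in> E \<Longrightarrow> a \<noteq> b \<Longrightarrow> EG.comb (\<lambda>_. 1) {a, b} = a \<oplus> b"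
  by (simp add: EG.comb_insert flip: carrier_G mult_G)

lemma comb_triple:
  "a \<in> E \<Longrightarrow> b \<in> E \<Longrightarrow> c \<in> E \<Longrightarrow> a \<noteq> b \<Longrightarrow> a \<noteq> c \<Longrightarrow> b \<noteq> c \<Longrightarrow>
    EG.comb (\<lambda>_. 1) {a, b, c} = a \<oplus> (b \<oplus> c)"
  by (simp add: EG.comb_insert flip: carrier_G mult_G)

text \<open>After saturation all seven nonempty partial sums of three points would have nonzero
  class, but three vectors in a plane over the field with two elements are dependent.\<close>

lemma card_le_2:
  assumes "int_independent G S" shows "card S \<le> 2"
proof (rule ccontr)
  assume "\<not> card S \<le> 2"
  then obtain U where U: "U \<subseteq> S" "card U = 3" using obtain_subset_with_card_n[of 3 S] by auto
  then have "card U \<le> 3" by simp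
  obtain S' where S': "int_independent G S'" "card S' = card U"
    and no: "\<And>V. V \<subseteq> S' \<Longrightarrow> V \<noteq> {} \<Longrightarrow> EG.comb (\<lambda>_. 1) V \<notin> EG.twice_mod_two_torsion"
    by (rule EG.saturate[OF EG.int_independent_subset[OF assms U(1)] \<open>card U \<le> 3\<close>]) (rule that)
  obtain a b c where abc: "S' = {a, b, c}" "a \<noteq> b" "a \<noteq> c" "b \<noteq> c" using S'(2) U(2) by (auto simp: card_3_iff)
  have E: "a \<in> E" "b \<in> E" "c \<in> E" using S'(1) abc by (auto simp: int_independent_def carrier_G)
  obtain i j i' j' i'' j'' where at: "attains a i j" "attains b i' j'" "attains c i'' j''"
    using exists_attains E by metis
  have n1: "\<not> attains (EG.comb (\<lambda>_. 1) V) False False" if "V \<subseteq> {a, b, c}" "V \<noteq> {}" for V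
    using attains_zero no[of V] that abc(1) by blast
  have n: "\<not> attains a False False" "\<not> attains b False False" "\<not> attains c False False"
    "\<not> attains (a \<oplus> b) False False" "\<not> attains (a \<oplus> c) False False" "\<not> attains (b \<oplus> c) False False"
    "\<not> attains (a \<oplus> (b \<oplus> c)) False False"
    using n1[of "{a}"] n1[of "{b}"] n1[of "{c}"] n1[of "{a, b}"] n1[of "{a, c}"] n1[of "{b, c}"] n1[of "{a, b, c}"]
    by (simp_all add: comb_singleton comb_pair comb_triple E abc)
  note s = attains_add[OF at(1,2)] attains_add[OF at(1,3)] attains_add[OF at(2,3)] attains_add[OF at(1) attains_add[OF at(2,3)]]
  show False using n at s
    by (cases i; cases j; cases i'; cases j'; cases i''; cases j''; simp)
qed

text \<open>Two saturated points have independent classes, so a, b and a + b run through all three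
  nonzero classes.\<close>

lemma normal_of_rank_2:
  assumes "int_independent G S" "card S = 2"
  shows "\<exists>P. normal P True False" "\<exists>P. normal P False True"
proof -
  have "card S \<le> 3" using assms(2) by simp
  obtain S' where S': "int_independent G S'" "card S' = card S"
    and no: "\<And>V. V \<subseteq> S' \<Longrightarrow> V \<noteq> {} \<Longrightarrow> EG.comb (\<lambda>_. 1) V \<notin> EG.twice_mod_two_torsion"
    by (rule EG.saturate[OF assms(1) \<open>card S \<le> 3\<close>]) (rule that)
  obtain a b where ab: "S' = {a, b}" "a \<noteq> b" using S'(2) assms(2) by (auto simp: card_2_iff)
  have E: "a \<in> E" "b \<in> E" using S'(1) ab by (auto simp: int_independent_def carrier_G)
  obtain i j i' j' where at: "attains a i j" "attains b i' j'" using exists_attains E by metis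
  have n1: "\<not> attains (EG.comb (\<lambda>_. 1) V) False False" if "V \<subseteq> {a, b}" "V \<noteq> {}" for V
    using attains_zero no[of V] that ab(1) by blast
  have n: "\<not> attains a False False" "\<not> attains b False False" "\<not> attains (a \<oplus> b) False False"
    using n1[of "{a}"] n1[of "{b}"] n1[of "{a, b}"] by (simp_all add: comb_singleton comb_pair E ab)
  have "\<exists>P. attains P True False" "\<exists>P. attains P False True"
    using n at attains_add[OF at]
    by (cases i; cases j; cases i'; cases j'; auto)+
  then show "\<exists>P. normal P True False" "\<exists>P. normal P False True" by (auto simp: attains_def)
qed

text \<open>Infinite descent on |a| + |b|, with the relation relaxed to a X + b Y = T for a
  2-torsion T so that it survives halving. X, Y and X + Y have nontrivial classes, so a and b are
  even. The half W has 2 W = T, hence 4 W = 0, and the absence of points of order 4 makes W a new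
  2-torsion value.\<close>

lemma independent_of_normal:
  assumes X: "normal X True False" and Y: "normal Y False True"
  shows "X \<noteq> Y" "int_independent G {X, Y}"
proof -
  have E: "X \<in> E" "Y \<in> E" using X Y by (auto simp: normal_def)
  have cX: "X \<in> carrier G" "Y \<in> carrier G" using E by (auto simp: carrier_G)
  have XY: "normal (X \<otimes>\<^bsub>G\<^esub> Y) True True" using normal_add[OF X Y] by (simp add: mult_G)
  show ne: "X \<noteq> Y"
  proof
    assume "X = Y"
    then have "X \<oplus> Y \<in> EG.twice_mod_two_torsion"
      unfolding twice_iff using E(1) by (intro bexI[of _ X] bexI[of _ Infinity]) auto
    then show False using normal_twice XY by (auto simp: mult_G)
  qed
  have step: "a = 0 \<and> b = 0" if T: "T \<in> carrier G" "T \<otimes>\<^bsub>G\<^esub> T = \<one>\<^bsub>G\<^esub>" "X [^]\<^bsub>G\<^esub> a \<otimes>\<^bsub>G\<^esub> Y [^]\<^bsub>G\<^esub> b = T"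
    for a b :: int and T
    using T
  proof (induction "nat (\<bar>a\<bar> + \<bar>b\<bar>)" arbitrary: a b T rule: less_induct)
    case less
    define a' b' where "a' = a div 2" and "b' = b div 2"
    define W where "W = X [^]\<^bsub>G\<^esub> a' \<otimes>\<^bsub>G\<^esub> Y [^]\<^bsub>G\<^esub> b'"
    define V where "V = X [^]\<^bsub>G\<^esub> (a mod 2) \<otimes>\<^bsub>G\<^esub> Y [^]\<^bsub>G\<^esub> (b mod 2)"
    have W: "W \<in> carrier G" and V: "V \<in> carrier G" using cX by (auto simp: W_def V_def)
    have split: "Z [^]\<^bsub>G\<^esub> k = Z [^]\<^bsub>G\<^esub> (k div 2) \<otimes>\<^bsub>G\<^esub> Z [^]\<^bsub>G\<^esub> (k div 2) \<otimes>\<^bsub>G\<^esub> Z [^]\<^bsub>G\<^esub> (k mod 2)"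
      if "Z \<in> carrier G" for Z and k :: int
    proof -
      have *: "k div 2 + k div 2 + k mod 2 = k" by simp
      show ?thesis
        using EG.int_pow_mult[OF that, of "k div 2 + k div 2" "k mod 2"] EG.int_pow_mult[OF that, of "k div 2" "k div 2"]
        unfolding * by (simp only:)
    qed
    have WV: "T = W \<otimes>\<^bsub>G\<^esub> W \<otimes>\<^bsub>G\<^esub> V"
    proof -
      note closed = cX EG.int_pow_closed EG.m_closed
      have "T = X [^]\<^bsub>G\<^esub> a \<otimes>\<^bsub>G\<^esub> Y [^]\<^bsub>G\<^esub> b" using less.prems(3) by (rule sym)
      also have "\<dots> = (X [^]\<^bsub>G\<^esub> a' \<otimes>\<^bsub>G\<^esub> X [^]\<^bsub>G\<^esub> a' \<otimes>\<^bsub>G\<^esub> X [^]\<^bsub>G\<^esub> (a mod 2)) \<otimes>\<^bsub>G\<^esub>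
          (Y [^]\<^bsub>G\<^esub> b' \<otimes>\<^bsub>G\<^esub> Y [^]\<^bsub>G\<^esub> b' \<otimes>\<^bsub>G\<^esub> Y [^]\<^bsub>G\<^esub> (b mod 2))"
        unfolding a'_def b'_def split[OF cX(1), of a, symmetric] split[OF cX(2), of b, symmetric] ..
      also have "\<dots> = W \<otimes>\<^bsub>G\<^esub> W \<otimes>\<^bsub>G\<^esub> V"
        unfolding W_def V_def by (simp only: EG.m_ac closed)
      finally show ?thesis .
    qed
    \<comment> \<open>Written as 2 (-W) + T, the combination V of the parities is a double plus
      2-torsion, hence of trivial class.\<close>
    have V_eq: "V = inv\<^bsub>G\<^esub> W \<otimes>\<^bsub>G\<^esub> inv\<^bsub>G\<^esub> W \<otimes>\<^bsub>G\<^esub> T"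
    proof -
      have "inv\<^bsub>G\<^esub> W \<otimes>\<^bsub>G\<^esub> inv\<^bsub>G\<^esub> W \<otimes>\<^bsub>G\<^esub> T = (inv\<^bsub>G\<^esub> W \<otimes>\<^bsub>G\<^esub> W) \<otimes>\<^bsub>G\<^esub> ((inv\<^bsub>G\<^esub> W \<otimes>\<^bsub>G\<^esub> W) \<otimes>\<^bsub>G\<^esub> V)"
        unfolding WV using W V by (simp only: EG.m_ac EG.m_closed EG.inv_closed)
      then show ?thesis using W V by simp
    qed
    have "V \<in> EG.twice_mod_two_torsion"
      unfolding EG.twice_mod_two_torsion_def using V_eq EG.inv_closed[OF W] less.prems(1,2)
      by (intro CollectI exI[of _ "inv\<^bsub>G\<^esub> W"] exI[of _ T] conjI)
    note V_twice = this
    have even: "a mod 2 = 0 \<and> b mod 2 = 0"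
    proof (rule ccontr)
      assume "\<not> (a mod 2 = 0 \<and> b mod 2 = 0)"
      then consider "a mod 2 = 1" "b mod 2 = 0" | "a mod 2 = 0" "b mod 2 = 1" | "a mod 2 = 1" "b mod 2 = 1"
        using not_mod_2_eq_0_eq_1 by blast
      then show False
      proof cases
        case 1
        then have "V = X" using cX by (simp add: V_def)
        then show False using normal_twice[OF X] V_twice by blast
      next
        case 2
        then have "V = Y" using cX by (simp add: V_def)
        then show False using normal_twice[OF Y] V_twice by blast
      next
        case 3
        then have "V = X \<otimes>\<^bsub>G\<^esub> Y" using cX by (simp add: V_def)
        then show False using normal_twice[OF XY] V_twice by blast
      qed
    qed
    then have "V = \<one>\<^bsub>G\<^esub>" by (simp add: V_def)
    with WV W have WT: "W \<otimes>\<^bsub>G\<^esub> W = T" by simp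
    have "W \<otimes>\<^bsub>G\<^esub> W = \<one>\<^bsub>G\<^esub>"
      using double_torsion_trivial[of W] W less.prems(2) unfolding WT[symmetric] carrier_G mult_G one_G by blast
    then have IH: "nat (\<bar>a'\<bar> + \<bar>b'\<bar>) < nat (\<bar>a\<bar> + \<bar>b\<bar>) \<Longrightarrow> a' = 0 \<and> b' = 0"
      using less.hyps[OF _ W _ W_def[symmetric]] by blast
    have ab: "a = 2 * a'" "b = 2 * b'" using even by (auto simp: a'_def b'_def)
    have "a' = 0 \<and> b' = 0"
    proof (rule ccontr)
      assume nz: "\<not> (a' = 0 \<and> b' = 0)"
      then have "nat (\<bar>a'\<bar> + \<bar>b'\<bar>) < nat (\<bar>a\<bar> + \<bar>b\<bar>)" unfolding ab by arith
      with IH nz show False by blast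
    qed
    then show ?case using ab by simp
  qed
  show "int_independent G {X, Y}"
    unfolding EG.int_independent_iff
  proof (intro conjI allI impI)
    fix c assume "EG.comb c {X, Y} = \<one>\<^bsub>G\<^esub>"
    then have "X [^]\<^bsub>G\<^esub> c X \<otimes>\<^bsub>G\<^esub> Y [^]\<^bsub>G\<^esub> c Y = \<one>\<^bsub>G\<^esub>"
      using cX ne by (simp add: EG.comb_insert)
    from step[OF _ _ this] show "\<forall>x\<in>{X, Y}. c x = 0" by simp
  qed (use cX in auto)
qed

lemma rank_eq_2_iff:
  "abelian_rank G = 2 \<longleftrightarrow> (\<exists>P. normal P True False) \<and> (\<exists>P. normal P False True)"
proof
  assume rk: "abelian_rank G = 2"
  have "\<exists>S. int_independent G S \<and> card S = 2"
  proof (rule ccontr)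
    assume "\<not> ?thesis"
    then have "card S \<le> 1" if "int_independent G S" for S using card_le_2[OF that] that by (cases "card S = 2") auto
    then have "abelian_rank G \<le> 1" unfolding abelian_rank_def by (intro SUP_least) (auto simp: one_enat_def)
    then show False unfolding rk by simp
  qed
  then show "(\<exists>P. normal P True False) \<and> (\<exists>P. normal P False True)" using normal_of_rank_2 by blast
next
  assume "(\<exists>P. normal P True False) \<and> (\<exists>P. normal P False True)"
  then obtain X Y where XY: "normal X True False" "normal Y False True" by blast
  have "enat (card {X, Y}) = 2" using independent_of_normal(1)[OF XY] by (simp add: numeral_eq_enat)
  moreover have "enat (card {X, Y}) \<le> abelian_rank G"
    unfolding abelian_rank_def using independent_of_normal[OF XY] by (intro SUP_upper) auto
  moreover have "abelian_rank G \<le> 2"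
    unfolding abelian_rank_def using card_le_2 by (intro SUP_least) (auto simp: numeral_eq_enat)
  ultimately show "abelian_rank G = 2" by simp
qed

end

theorem theorem3p42:
  fixes p :: int
  assumes "prime p" and "odd p"
  shows "abelian_rank (ec_group (- ((of_int p :: rat) ^ 2)) 0) = 2 \<longleftrightarrow>
    alpha_minus_pm_Pythagorean p \<and> beta_minus_Pythagorean p"
proof -
  interpret congruent_prime p using assms by unfold_locales
  show ?thesis
    using rank_eq_2_iff alpha_imp_normal normal_imp_alpha beta_imp_normal normal_imp_beta
    unfolding n_def by blast
qed

end
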